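(* Let $n\ge2$. Let $1<p<\infty$ and $\varepsilon>0$ be such that $$0<\varepsilon<\min\left\{\frac{(n-1)\big(1-\frac1p\big)}{1+pn-p},\frac1p\right\}.$$ Then $$\mathrm{BD}(\mathbb{R}^n)\cap\mathrm{BMO}(\mathbb{R}^n;\mathbb{R}^n)\subset W^{\frac1p-\varepsilon,p}(\mathbb{R}^n;\mathbb{R}^n).$$
   Context: $\mathrm{BD}(\mathbb{R}^n)$ is the space of $u\in L^1(\mathbb{R}^n;\mathbb{R}^n)$ whose distributional symmetric gradient $\frac12(Du+D^{\mathsf T}u)$ is a finite $\mathbb{R}^{n\times n}_{\mathrm{sym}}$-valued Radon measure. A locally integrable $u:\mathbb{R}^n\to\mathbb{R}^N$ belongs to $\mathrm{BMO}(\mathbb{R}^n;\mathbb{R}^N)$ if its centred sharp maximal function $(\mathcal{M}^\#u)(x)=\sup_{Q}\frac{1}{\mathscr{L}^n(Q)}\int_Q|u-(u)_Q|\,dy$ (supremum over cubes $Q$ centred at $x$, $(u)_Q$ the mean of $u$ over $Q$) belongs to $L^\infty(\mathbb{R}^n)$. For $0<s<1$ and $1\le p<\infty$, $W^{s,p}(\mathbb{R}^n;\mathbb{R}^n)$ is the fractional Sobolev space of all $u\in L^p$ with $\iint\frac{|u(x)-u(y)|^p}{|x-y|^{n+sp}}\,dx\,dy<\infty$. *)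

theory Defs
  imports "HOL-Analysis.Analysis"
begin

definition partial_deriv :: "'n::finite \<Rightarrow> (real^'n \<Rightarrow> real) \<Rightarrow> real^'n \<Rightarrow> real"
  where "partial_deriv j f x = frechet_derivative f (at x) (axis j 1)"

(* Differentiability at every stage makes the Frechet derivative, an epsilon-term,
   meaningful. *)
primrec C_k :: "nat \<Rightarrow> (real^'n::finite \<Rightarrow> real) \<Rightarrow> bool"
  where
    "C_k 0 f \<longleftrightarrow> continuous_on UNIV f"
  | "C_k (Suc k) f \<longleftrightarrow> (\<forall>x. f differentiable at x) \<and> (\<forall>j. C_k k (partial_deriv j f))"

definition test_function :: "(real^'n::finite \<Rightarrow> real) \<Rightarrow> bool"
  where "test_function f \<longleftrightarrow> (\<forall>k. C_k k f) \<and> compact (closure {x. f x \<noteq> 0})"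

(* A vector-valued measure is a countably additive set function on the Borel sets
   (values elsewhere are irrelevant).  Having finite values it has finite total
   variation, and on Euclidean space it is then automatically Radon. *)
definition finite_radon_measure ::
    "((real^'n::finite) set \<Rightarrow> 'b::real_normed_vector) \<Rightarrow> bool"
  where "finite_radon_measure \<mu> \<longleftrightarrow>
    (\<forall>A::nat \<Rightarrow> (real^'n) set. range A \<subseteq> sets borel \<longrightarrow> disjoint_family A \<longrightarrow>
      (\<lambda>k. \<mu> (A k)) sums \<mu> (\<Union>k. A k))"

(* Integral of a bounded Borel function against a real signed measure, through a
   decomposition into finite positive measures.  One exists by the Jordan decomposition
   theorem, and the value I does not depend on the choice: two decompositions P - N and
   P' - N' satisfy P + N' = P' + N. *)
definition has_signed_integral ::
    "((real^'n::finite) set \<Rightarrow> real) \<Rightarrow> (real^'n \<Rightarrow> real) \<Rightarrow> real \<Rightarrow> bool"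
  where "has_signed_integral \<mu> f I \<longleftrightarrow>
    (\<exists>P N. finite_measure P \<and> finite_measure N \<and> sets P = sets borel \<and> sets N = sets borel \<and>
      (\<forall>B\<in>sets borel. \<mu> B = measure P B - measure N B) \<and>
      I = (LINT x|P. f x) - (LINT x|N. f x))"

(* The (i,j) entry of (Du + D^T u)/2, as a distribution, applied to f. *)
definition distr_sym_grad ::
    "(real^'n \<Rightarrow> real^'n) \<Rightarrow> 'n::finite \<Rightarrow> 'n \<Rightarrow> (real^'n \<Rightarrow> real) \<Rightarrow> real"
  where "distr_sym_grad u i j f =
    - (1/2) * (LINT x|lebesgue. u x $ i * partial_deriv j f x + u x $ j * partial_deriv i f x)"

(* Function spaces are rendered as sets of representatives, i.e. of Lebesgue measurable
   functions not identified almost everywhere. *)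

definition BD :: "(real^'n::finite \<Rightarrow> real^'n) set"
  where "BD = {u. integrable lebesgue u \<and>
    (\<exists>\<mu> :: (real^'n) set \<Rightarrow> real^'n^'n.
      finite_radon_measure \<mu> \<and>
      (\<forall>B\<in>sets borel. transpose (\<mu> B) = \<mu> B) \<and>
      (\<forall>f i j. test_function f \<longrightarrow>
        has_signed_integral (\<lambda>B. \<mu> B $ i $ j) f (distr_sym_grad u i j f)))}"

(* The closed cube of side length 2 r with sides parallel to the axes. *)
definition cube :: "real^'n::finite \<Rightarrow> real \<Rightarrow> (real^'n) set"
  where "cube x r = cbox (\<chi> i. x $ i - r) (\<chi> i. x $ i + r)"

definition mean :: "(real^'n::finite) set \<Rightarrow> (real^'n \<Rightarrow> real^'m::finite) \<Rightarrow> real^'m"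
  where "mean Q u = (1 / measure lebesgue Q) *\<^sub>R (LINT y:Q|lebesgue. u y)"

definition sharp_maximal ::
    "(real^'n::finite \<Rightarrow> real^'m::finite) \<Rightarrow> real^'n \<Rightarrow> ennreal"
  where "sharp_maximal u x =
    (SUP r\<in>{0<..}. (\<integral>\<^sup>+y\<in>cube x r. ennreal (norm (u y - mean (cube x r) u)) \<partial>lebesgue)
      / emeasure lebesgue (cube x r))"

definition L_infinity :: "(real^'n::finite \<Rightarrow> ennreal) set"
  where "L_infinity = {g. g \<in> borel_measurable lebesgue \<and>
    (\<exists>C::real. AE x in lebesgue. g x \<le> ennreal C)}"

definition BMO :: "(real^'n::finite \<Rightarrow> real^'m::finite) set"
  where "BMO = {u. (\<forall>K. compact K \<longrightarrow> set_integrable lebesgue K u) \<and> sharp_maximal u \<in> L_infinity}"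

(* For 0 < s < 1 and 1 \<le> p < \<infinity>.  On the null diagonal the quotient is 0 / 0 = 0. *)
definition frac_sobolev :: "real \<Rightarrow> real \<Rightarrow> (real^'n::finite \<Rightarrow> real^'m::finite) set"
  where "frac_sobolev s p = {u. u \<in> borel_measurable lebesgue \<and>
    (\<integral>\<^sup>+x. ennreal (norm (u x) powr p) \<partial>lebesgue) < \<infinity> \<and>
    (\<integral>\<^sup>+x. (\<integral>\<^sup>+y. ennreal (norm (u x - u y) powr p / norm (x - y) powr (real CARD('n) + s * p))
      \<partial>lebesgue) \<partial>lebesgue) < \<infinity>}"

end

theory Submission
  imports Defs
begin

text \<open>
  Only the symmetric part of \<open>Du\<close> is controlled, so testing gives
  \<open>\<parallel>(u(\<cdot> + \<xi>) - u) \<bullet> \<xi>\<parallel>\<^sub>1 \<le> C \<bar>\<xi>\<bar>\<^sup>2\<close>. Using this along \<open>t e_i\<close>, \<open>s e_j\<close>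
  and \<open>t e_i + s e_j\<close> bounds second differences of each component in \<open>L\<^sup>1\<close> linearly in the step,
  hence \<open>\<parallel>u(\<cdot> + h) - u\<parallel>\<^sub>1 \<le> K \<bar>h\<bar> powr \<sigma>\<close> for every \<open>\<sigma> < 1\<close>. Since \<open>u\<close> is
  integrable and in BMO, a John-Nirenberg argument puts it in \<open>L\<^sup>q\<close> for all finite \<open>q\<close>.
  Interpolating the differences between \<open>L\<^sup>1\<close> and \<open>L\<^sup>q\<close> with \<open>q\<close> large gives
  \<open>\<parallel>u(\<cdot> + h) - u\<parallel>\<^sub>p\<^sup>p \<le> K \<bar>h\<bar> powr \<gamma>\<close> for every \<open>\<gamma> < 1\<close>, and this suffices
  because \<open>s p < 1\<close>.
\<close>

subsection \<open>Test functions and duality\<close>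

text \<open>BD alone cannot give differences that are linear in the step in
  \<open>L\<^sup>1\<close>: such an estimate would place \<open>u\<close> in BV, which Ornstein's
  non-inequality rules out for general BD functions. In the proof the loss appears in the recursion
  \<open>f t \<le> f (2 * t) / 2 + b * t\<close>, critical at exponent 1: each dyadic scale adds
  another multiple of t, hence t log (1/t) in total. The loss is affordable because s p = 1 -
  \<epsilon> p stays below 1. This leaves room for \<gamma> between s p and 1 and for \<sigma>
  between \<gamma> and 1; the gap from \<gamma> to \<sigma> pays for the interpolation with
  \<open>L\<^sup>q\<close>. The symmetric gradient is seen only through smooth compactly supported
  functions, so an \<open>L\<^sup>1\<close> norm has to be recovered from these by duality. They are
  built as polynomials times a flat radial profile, and their density comes from Stone-Weierstrass
  rather than from mollification. All estimates are made for a Borel function \<open>u'\<close>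
  equal to \<open>u\<close> almost everywhere.\<close>

definition flat_exp :: "nat \<Rightarrow> real \<Rightarrow> real"
  where "flat_exp m t = (if 0 < t then exp (- (1 / t)) / t ^ m else 0)"

lemma flat_exp_0_bounds: "0 \<le> flat_exp 0 t" "flat_exp 0 t \<le> 1"
  by (auto simp: flat_exp_def)

lemma flat_exp_0_mono: "s \<le> t \<Longrightarrow> flat_exp 0 s \<le> flat_exp 0 t"
  by (auto simp: flat_exp_def frac_le)

text \<open>This is the difference quotient at 0, the only point where smoothness is in doubt. From
  the right, x = 1/t turns it into x^(m+1) / exp x at infinity.\<close>

lemma flat_exp_div_tendsto_0: "((\<lambda>t. flat_exp m t / t) \<longlongrightarrow> 0) (at 0)"
proof -
  have "((\<lambda>x::real. x ^ Suc m / exp x) \<longlongrightarrow> 0) at_top"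
    by (rule tendsto_power_div_exp_0)
  then have "((\<lambda>t::real. (inverse t) ^ Suc m / exp (inverse t)) \<longlongrightarrow> 0) (at_right 0)"
    by (rule filterlim_compose[OF _ filterlim_inverse_at_top_right])
  moreover have "\<forall>\<^sub>F t in at_right (0::real). (inverse t) ^ Suc m / exp (inverse t) = flat_exp m t / t"
    unfolding eventually_at_right_field
    by (rule exI[of _ 1]) (auto simp: flat_exp_def exp_minus field_simps)
  ultimately have r: "((\<lambda>t. flat_exp m t / t) \<longlongrightarrow> 0) (at_right 0)"
    by (simp add: filterlim_cong)
  have l: "((\<lambda>t. flat_exp m t / t) \<longlongrightarrow> 0) (at_left 0)"
    by (rule tendsto_eventually)
       (auto simp: eventually_at_left_field flat_exp_def intro!: exI[of _ "-1"])
  show ?thesis using filterlim_split_at[OF l r] .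
qed

text \<open>The powers in the denominator are there for this formula: the family is closed under
  differentiation up to linear combinations, so one first-order computation yields smoothness of
  every order.\<close>

lemma flat_exp_has_real_derivative:
  "(flat_exp m has_real_derivative flat_exp (m + 2) t - real m * flat_exp (m + 1) t) (at t)"
proof -
  consider "t < 0" | "t = 0" | "t > 0" by linarith
  then show ?thesis
  proof cases
    case 1
    have "((\<lambda>_. 0) has_real_derivative 0) (at t)" by simp
    moreover have "\<forall>\<^sub>F s in nhds t. flat_exp m s = 0"
      using eventually_nhds_in_open[of "{..<0}" t] 1
      by (auto simp: flat_exp_def elim!: eventually_mono)
    ultimately have "(flat_exp m has_real_derivative 0) (at t)"
      using DERIV_cong_ev[of t t "flat_exp m" "\<lambda>_. 0" 0 0] by auto
    then show ?thesis using 1 by (simp add: flat_exp_def)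
  next
    case 2
    then show ?thesis using flat_exp_div_tendsto_0[of m]
      by (simp add: has_field_derivative_iff flat_exp_def)
  next
    case 3
    have "((\<lambda>s. exp (- (1 / s)) / s ^ m) has_real_derivative
       (exp (-(1/t)) * (1 / (t * t)) * t ^ m - exp (-(1/t)) * (m * t ^ (m - 1))) / (t ^ m * t ^ m)) (at t)"
      using 3 by (auto intro!: derivative_eq_intros)
    also have "(exp (-(1/t)) * (1 / (t * t)) * t ^ m - exp (-(1/t)) * (m * t ^ (m - 1))) / (t ^ m * t ^ m)
       = flat_exp (m + 2) t - real m * flat_exp (m + 1) t"
      using 3 by (cases m) (auto simp: flat_exp_def field_simps power2_eq_square)
    finally have *: "((\<lambda>s. exp (- (1 / s)) / s ^ m) has_real_derivative
       flat_exp (m + 2) t - real m * flat_exp (m + 1) t) (at t)" .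
    have "\<forall>\<^sub>F s in nhds t. flat_exp m s = exp (- (1 / s)) / s ^ m"
      using eventually_nhds_in_open[of "{0<..}" t] 3
      by (auto simp: flat_exp_def elim!: eventually_mono)
    then show ?thesis
      using * DERIV_cong_ev[of t t "flat_exp m" "\<lambda>s. exp (- (1 / s)) / s ^ m"] by auto
  qed
qed

section \<open>Partial derivatives of polynomials and of bump functions\<close>

lemma partial_deriv_eq:
  assumes "(f has_derivative D) (at x)"
  shows "partial_deriv j f x = D (axis j 1)"
  unfolding partial_deriv_def using frechet_derivative_at[OF assms] by simp

lemma frechet_derivative_eq_sum_partial_deriv:
  fixes f :: "real^'n::finite \<Rightarrow> real"
  assumes "f differentiable at x"
  shows "frechet_derivative f (at x) \<xi> = (\<Sum>j\<in>UNIV. \<xi> $ j * partial_deriv j f x)"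
proof -
  interpret bounded_linear "frechet_derivative f (at x)"
    using assms frechet_derivative_works has_derivative_bounded_linear by blast
  have "\<xi> = (\<Sum>j\<in>UNIV. \<xi> $ j *\<^sub>R axis j 1)"
    by (metis basis_expansion scalar_mult_eq_scaleR)
  then have "frechet_derivative f (at x) \<xi> =
      frechet_derivative f (at x) (\<Sum>j\<in>UNIV. \<xi> $ j *\<^sub>R axis j 1)" by simp
  then show ?thesis
    by (simp add: sum scaleR partial_deriv_def)
qed

lemma real_polynomial_function_partial_deriv:
  fixes P :: "real^'n::finite \<Rightarrow> real"
  assumes "real_polynomial_function P"
  shows "\<exists>Q. real_polynomial_function Q \<and>
    (\<forall>x. \<exists>D. (P has_derivative D) (at x) \<and> D (axis j 1) = Q x)"
  using assms
proof (induction P rule: real_polynomial_function.induct)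
  case (linear f)
  then show ?case
    by (intro exI[of _ "\<lambda>_. f (axis j 1)"])
       (auto intro: bounded_linear_imp_has_derivative)
next
  case (const c)
  then show ?case
    by (intro exI[of _ "\<lambda>_. 0"]) (auto intro!: exI[of _ "\<lambda>_. 0"])
next
  case (add f g)
  then obtain Qf Qg where Q: "real_polynomial_function Qf" "real_polynomial_function Qg"
    "\<And>x. \<exists>D. (f has_derivative D) (at x) \<and> D (axis j 1) = Qf x"
    "\<And>x. \<exists>D. (g has_derivative D) (at x) \<and> D (axis j 1) = Qg x" by blast
  have "\<exists>D. ((\<lambda>x. f x + g x) has_derivative D) (at x) \<and> D (axis j 1) = Qf x + Qg x" for x
  proof -
    obtain D D' where "(f has_derivative D) (at x)" "D (axis j 1) = Qf x"
      "(g has_derivative D') (at x)" "D' (axis j 1) = Qg x"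
      using Q(3)[of x] Q(4)[of x] by auto
    then show ?thesis
      by (intro exI[of _ "\<lambda>h. D h + D' h"]) (auto intro!: has_derivative_add)
  qed
  then show ?case using Q by (intro exI[of _ "\<lambda>x. Qf x + Qg x"]) auto
next
  case (mult f g)
  then obtain Qf Qg where Q: "real_polynomial_function Qf" "real_polynomial_function Qg"
    "\<And>x. \<exists>D. (f has_derivative D) (at x) \<and> D (axis j 1) = Qf x"
    "\<And>x. \<exists>D. (g has_derivative D) (at x) \<and> D (axis j 1) = Qg x" by blast
  have "\<exists>D. ((\<lambda>x. f x * g x) has_derivative D) (at x) \<and> D (axis j 1) = f x * Qg x + Qf x * g x" for x
  proof -
    obtain D D' where "(f has_derivative D) (at x)" "D (axis j 1) = Qf x"
      "(g has_derivative D') (at x)" "D' (axis j 1) = Qg x"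
      using Q(3)[of x] Q(4)[of x] by auto
    then show ?thesis
      by (intro exI[of _ "\<lambda>h. f x * D' h + D h * g x"]) (auto intro!: has_derivative_mult)
  qed
  then show ?case using Q mult
    by (intro exI[of _ "\<lambda>x. f x * Qg x + Qf x * g x"]) (auto)
qed

text \<open>Being closed under partial derivatives, this class consists of smooth functions.\<close>

inductive poly_bump :: "real \<Rightarrow> (real^'n::finite \<Rightarrow> real) \<Rightarrow> bool" for \<rho>
  where
    single: "real_polynomial_function P \<Longrightarrow> poly_bump \<rho> (\<lambda>x. P x * flat_exp m (\<rho> - x \<bullet> x))"
  | add: "poly_bump \<rho> f \<Longrightarrow> poly_bump \<rho> g \<Longrightarrow> poly_bump \<rho> (\<lambda>x. f x + g x)"

lemma poly_bump_partial_deriv: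
  fixes f :: "real^'n::finite \<Rightarrow> real"
  assumes "poly_bump \<rho> f"
  shows "(\<forall>x. f differentiable at x) \<and> poly_bump \<rho> (partial_deriv j f)"
  using assms
proof induction
  case (single P m)
  obtain Q where Q: "real_polynomial_function Q"
    and D: "\<And>x. \<exists>D. (P has_derivative D) (at x) \<and> D (axis j 1) = Q x"
    using real_polynomial_function_partial_deriv[OF single] by blast
  let ?e = "\<lambda>k x. flat_exp k (\<rho> - x \<bullet> x)"
  let ?f = "\<lambda>x. P x * ?e m x"
  \<comment> \<open>Product and chain rule: the gradient of \<rho> - x \<bullet> x contributes - 2
    x_j, and the derivative of \<open>flat_exp m\<close> splits into the profiles of index m + 2 and
    m + 1.\<close>
  let ?g = "\<lambda>x. Q x * ?e m x + ((- 2 * x $ j) * P x * ?e (m + 2) x + (2 * real m * x $ j) * P x * ?e (m + 1) x)"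
  have *: "?f differentiable at x" "partial_deriv j ?f x = ?g x" for x
  proof -
    obtain D' where D': "(P has_derivative D') (at x)" "D' (axis j 1) = Q x" using D by blast
    let ?d = "flat_exp (m + 2) (\<rho> - x \<bullet> x) - real m * flat_exp (m + 1) (\<rho> - x \<bullet> x)"
    have "((\<lambda>x. \<rho> - x \<bullet> x) has_derivative (\<lambda>h. - 2 * (x \<bullet> h))) (at x)"
      by (auto intro!: derivative_eq_intros simp: inner_commute)
    then have "(?e m has_derivative (\<lambda>h. - 2 * (x \<bullet> h) * ?d)) (at x)"
      using DERIV_compose_FDERIV[OF flat_exp_has_real_derivative] by blast
    with D'(1) have "(?f has_derivative (\<lambda>h. P x * (- 2 * (x \<bullet> h) * ?d) + D' h * ?e m x)) (at x)"
      by (rule has_derivative_mult)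
    then show "?f differentiable at x" "partial_deriv j ?f x = ?g x"
      by (auto simp: differentiable_def partial_deriv_eq D'(2) inner_axis algebra_simps)
  qed
  have lin: "real_polynomial_function (\<lambda>x::real^'n. x $ j)"
    by (intro real_polynomial_function.intros(1) bounded_linear_vec_nth)
  have "poly_bump \<rho> ?g"
    by (intro poly_bump.add poly_bump.single real_polynomial_function.intros(4)
        real_polynomial_function.intros(2) single Q lin)
  moreover have "partial_deriv j ?f = ?g" using *(2) by blast
  ultimately show ?case using *(1) by metis
next
  case (add f g)
  have "partial_deriv j (\<lambda>x. f x + g x) x = partial_deriv j f x + partial_deriv j g x" for x
  proof -
    have "((\<lambda>x. f x + g x) has_derivative
        (\<lambda>h. frechet_derivative f (at x) h + frechet_derivative g (at x) h)) (at x)"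
      using add.IH by (intro has_derivative_add) (simp_all add: frechet_derivative_works[symmetric])
    then show ?thesis by (simp add: partial_deriv_eq) (simp add: partial_deriv_def)
  qed
  then have "partial_deriv j (\<lambda>x. f x + g x) = (\<lambda>x. partial_deriv j f x + partial_deriv j g x)"
    by blast
  then show ?case using add.IH by (auto intro: poly_bump.add)
qed

lemma poly_bump_C_k: "poly_bump \<rho> f \<Longrightarrow> C_k k f"
proof (induction k arbitrary: f)
  case 0
  then show ?case using poly_bump_partial_deriv[OF 0]
    by (auto intro!: continuous_at_imp_continuous_on differentiable_imp_continuous_within)
next
  case (Suc k)
  then show ?case using poly_bump_partial_deriv[OF Suc.prems] by auto
qed

lemma test_function_poly_bump:
  fixes P :: "real^'n::finite \<Rightarrow> real"
  assumes "real_polynomial_function P"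
  shows "test_function (\<lambda>x. P x * flat_exp 0 (\<rho> - x \<bullet> x))"
proof -
  have "{x. P x * flat_exp 0 (\<rho> - x \<bullet> x) \<noteq> 0} \<subseteq> cball 0 (sqrt \<rho>)"
    by (auto simp: flat_exp_def norm_eq_sqrt_inner split: if_splits)
  then have "bounded {x. P x * flat_exp 0 (\<rho> - x \<bullet> x) \<noteq> 0}"
    using bounded_cball bounded_subset by blast
  then show ?thesis
    using poly_bump_C_k[OF poly_bump.single[OF assms]]
    by (auto simp: test_function_def compact_closure)
qed

section \<open>Translates, bounds and density of test functions\<close>

lemma C_k_translate: "C_k k f \<Longrightarrow> C_k k (\<lambda>x. f (x - c))"
proof (induction k arbitrary: f)
  case 0
  then show ?case by (auto intro!: continuous_intros continuous_on_compose2[of UNIV f])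
next
  case (Suc k)
  have D: "((\<lambda>x. f (x - c)) has_derivative frechet_derivative f (at (x - c))) (at x)" for x
  proof -
    have "(f has_derivative frechet_derivative f (at (x - c))) (at (x - c))"
      using Suc.prems by (simp add: frechet_derivative_works)
    moreover have "((\<lambda>x. x - c) has_derivative (\<lambda>h. h)) (at x)"
      by (auto intro!: derivative_eq_intros)
    ultimately show ?thesis
      using has_derivative_compose[of "\<lambda>x. x - c" "\<lambda>h. h" x UNIV f] by auto
  qed
  have "partial_deriv j (\<lambda>x. f (x - c)) = (\<lambda>x. partial_deriv j f (x - c))" for j
    using partial_deriv_eq[OF D] by (auto simp: partial_deriv_def)
  then show ?case using Suc D by (auto simp: differentiable_def)
qed

lemma test_function_translate:
  fixes f :: "real^'n::finite \<Rightarrow> real"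
  assumes "test_function f"
  shows "test_function (\<lambda>x. f (x - c))"
proof -
  have "bounded {x. f x \<noteq> 0}"
    using assms unfolding test_function_def compact_closure by blast
  then have "bounded ((\<lambda>x. c + x) ` {x. f x \<noteq> 0})" by (rule bounded_translation)
  moreover have "{x. f (x - c) \<noteq> 0} \<subseteq> (\<lambda>x. c + x) ` {x. f x \<noteq> 0}"
    by (auto simp: image_iff intro!: exI[of _ "x - c" for x])
  ultimately have "bounded {x. f (x - c) \<noteq> 0}" using bounded_subset by blast
  then show ?thesis using assms C_k_translate[of _ f c]
    unfolding test_function_def compact_closure by blast
qed

lemma
  assumes "test_function f"
  shows test_function_differentiable: "f differentiable at x"
    and test_function_continuous: "continuous_on UNIV f"
    and test_function_continuous_partial: "continuous_on UNIV (partial_deriv j f)"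
proof -
  have "C_k (Suc 0) f" "C_k 0 f" using assms unfolding test_function_def by blast+
  then show "f differentiable at x" "continuous_on UNIV f" "continuous_on UNIV (partial_deriv j f)"
    by auto
qed

lemma bounded_if_continuous_compact_support:
  fixes f :: "'a::euclidean_space \<Rightarrow> real"
  assumes "continuous_on UNIV f" "compact K" "\<And>x. x \<notin> K \<Longrightarrow> f x = 0"
  obtains B where "0 \<le> B" "\<And>x. \<bar>f x\<bar> \<le> B"
proof -
  have "bounded (f ` K)"
    using assms by (meson compact_continuous_image compact_imp_bounded continuous_on_subset subset_UNIV)
  then obtain B where B: "\<And>x. x \<in> K \<Longrightarrow> \<bar>f x\<bar> \<le> B" "0 < B"
    by (auto simp: bounded_pos)
  have "\<bar>f x\<bar> \<le> B" for x using B assms(3)[of x] by (cases "x \<in> K") auto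
  then show ?thesis using that[of B] B by auto
qed

lemma test_function_partial_deriv_bounded:
  fixes f :: "real^'n::finite \<Rightarrow> real"
  assumes "test_function f"
  obtains B where "0 \<le> B" "\<And>x. \<bar>partial_deriv j f x\<bar> \<le> B"
proof -
  let ?K = "closure {x. f x \<noteq> 0}"
  have "partial_deriv j f x = 0" if x: "x \<notin> ?K" for x
  proof -
    have "((\<lambda>_. 0) has_derivative (\<lambda>_. 0)) (at x)" by simp
    moreover have "open (- ?K)" "x \<in> - ?K" using x by auto
    moreover have "0 = f y" if "y \<in> - ?K" for y using that closure_subset[of "{x. f x \<noteq> 0}"] by auto
    ultimately have "(f has_derivative (\<lambda>_. 0)) (at x)"
      by (rule has_derivative_transform_within_open) simp
    then show ?thesis by (simp add: partial_deriv_eq)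
  qed
  moreover have "compact ?K" using assms unfolding test_function_def by blast
  ultimately show ?thesis
    using bounded_if_continuous_compact_support[OF test_function_continuous_partial[OF assms]] that
    by (metis (no_types, lifting))
qed

text \<open>Dividing \<open>g\<close> by a bump \<eta> that is positive on the support of
  \<open>g\<close>, approximating the quotient by a polynomial and multiplying back by \<eta>
  produces a test function. Since 0 \<le> \<eta> \<le> 1, the multiplication does not increase the
  error.\<close>

lemma approx_by_test_function:
  fixes g :: "real^'n::finite \<Rightarrow> real"
  assumes g: "continuous_on UNIV g" and r: "0 < r" and supp: "\<And>x. r \<le> norm x \<Longrightarrow> g x = 0"
    and e: "0 < e"
  obtains \<phi> where "test_function \<phi>" "\<And>x. \<bar>\<phi> x - g x\<bar> \<le> e"
proof -
  \<comment> \<open>The radius r + 1 exceeds r, so \<eta> has the positive lower bound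
    \<open>c\<close> on the ball of radius r, while it vanishes beyond the ball on which the
    polynomial approximation is controlled.\<close>
  define \<eta> where "\<eta> x = flat_exp 0 ((r + 1)\<^sup>2 - x \<bullet> x)" for x :: "real^'n"
  define c where "c = flat_exp 0 ((r + 1)\<^sup>2 - r\<^sup>2)"
  have c: "0 < c" using r by (auto simp: c_def flat_exp_def power_strict_mono)
  have \<eta>c: "c \<le> \<eta> x" if "norm x \<le> r" for x
    using that r unfolding c_def \<eta>_def
    by (intro flat_exp_0_mono) (auto simp: dot_square_norm intro!: power_mono)
  have cont: "continuous_on UNIV \<eta>"
    using test_function_continuous[OF test_function_poly_bump[OF real_polynomial_function.intros(2)[of 1]]]
    by (simp add: \<eta>_def[abs_def])
  \<comment> \<open>The maximum with \<open>c\<close> keeps the denominator away from 0. It changes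
    \<eta> only where \<open>g\<close> vanishes.\<close>
  have "continuous_on UNIV (\<lambda>x. g x / max (\<eta> x) c)"
    using c by (intro continuous_on_divide continuous_on_max continuous_on_const g cont) (auto simp: max_def)
  then have "continuous_on (cball 0 (r + 1)) (\<lambda>x. g x / max (\<eta> x) c)"
    by (rule continuous_on_subset) simp
  then obtain P where P: "real_polynomial_function P"
    "\<And>x. x \<in> cball 0 (r + 1) \<Longrightarrow> \<bar>g x / max (\<eta> x) c - P x\<bar> < e"
    by (rule Stone_Weierstrass_real_polynomial_function[OF compact_cball _ e]) blast
  have "\<bar>P x * \<eta> x - g x\<bar> \<le> e" for x
  proof -
    have "g x = g x / max (\<eta> x) c * \<eta> x"
      using \<eta>c[of x] supp[of x] c by (cases "norm x \<le> r") (auto simp: max_def)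
    then have "\<bar>P x * \<eta> x - g x\<bar> = \<bar>(P x - g x / max (\<eta> x) c) * \<eta> x\<bar>"
      by (simp add: algebra_simps)
    also have "\<dots> = \<bar>g x / max (\<eta> x) c - P x\<bar> * \<eta> x"
      using flat_exp_0_bounds by (simp add: abs_mult \<eta>_def abs_minus_commute)
    also have "\<dots> \<le> e"
    proof (cases "x \<in> cball 0 (r + 1)")
      case True
      then have "\<bar>g x / max (\<eta> x) c - P x\<bar> * \<eta> x \<le> e * 1"
        using P(2)[OF True] flat_exp_0_bounds e by (intro mult_mono) (auto simp: \<eta>_def)
      then show ?thesis by simp
    next
      case False
      then have "(r + 1)\<^sup>2 \<le> x \<bullet> x"
        using r by (auto simp: dot_square_norm intro!: power_mono)
      then have "\<eta> x = 0" by (simp add: \<eta>_def flat_exp_def)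
      then show ?thesis using e by simp
    qed
    finally show ?thesis .
  qed
  then show ?thesis
    using that[OF test_function_poly_bump[OF P(1)], of "(r + 1)\<^sup>2"] by (simp add: \<eta>_def)
qed

text \<open>The optimal multiplier is sgn v. It is an almost everywhere limit of test functions
  bounded by 1 + 1/(n+1), and dominated convergence carries the tested bound to the limit.\<close>

lemma L1_norm_le_if_tested:
  fixes v :: "real^'n::finite \<Rightarrow> real"
  assumes v: "integrable lborel v"
    and le: "\<And>\<phi> M. test_function \<phi> \<Longrightarrow> (\<And>x. \<bar>\<phi> x\<bar> \<le> M) \<Longrightarrow> \<bar>LINT x|lborel. v x * \<phi> x\<bar> \<le> C * M"
  shows "(LINT x|lborel. \<bar>v x\<bar>) \<le> C"
proof -
  have [measurable]: "v \<in> borel_measurable borel" using v by auto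
  have "(\<lambda>x. sgn (v x)) \<in> borel_measurable lborel"
    by (simp add: borel_measurable_sgn)
  then have "(\<lambda>x. sgn (v x)) measurable_on UNIV"
    by (intro lebesgue_measurable_imp_measurable_on) (auto intro: measurable_completion)
  then obtain N g where N: "negligible N" and g: "\<And>n. continuous_on UNIV (g n)"
    and lim: "\<And>x. x \<notin> N \<Longrightarrow> (\<lambda>n. g n x) \<longlonglongrightarrow> sgn (v x)"
    unfolding measurable_on_def by auto
  \<comment> \<open>Clamping to [-1, 1] leaves the limit sgn v intact. The tent factor equals 1 on
    the ball of radius n and vanishes from radius n + 1 on, which makes the support bounded.\<close>
  define G where "G n x = max (-1) (min 1 (g n x)) * max 0 (min 1 (real n + 1 - norm x))"
    for n :: nat and x :: "real^'n"
  have "\<exists>\<phi>. test_function \<phi> \<and> (\<forall>x. \<bar>\<phi> x - G n x\<bar> \<le> 1 / (real n + 1))" for n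
  proof -
    have "continuous_on UNIV (G n)" unfolding G_def by (intro continuous_intros g)
    then show ?thesis
      by (rule approx_by_test_function[of "G n" "real n + 1" "1 / (real n + 1)"])
         (auto simp: G_def)
  qed
  then obtain \<phi> where \<phi>: "\<And>n. test_function (\<phi> n)" "\<And>n x. \<bar>\<phi> n x - G n x\<bar> \<le> 1 / (real n + 1)"
    by metis
  have G1: "\<bar>G n x\<bar> \<le> 1" for n x
    unfolding G_def abs_mult by (intro mult_le_one) auto
  have bd: "\<bar>\<phi> n x\<bar> \<le> 1 + 1 / (real n + 1)" for n x
    using \<phi>(2)[of n x] G1[of n x] by linarith
  have inv0: "(\<lambda>n. 1 / (real n + 1)) \<longlonglongrightarrow> 0"
    using LIMSEQ_inverse_real_of_nat by (simp add: inverse_eq_divide add.commute)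
  have lim\<phi>: "(\<lambda>n. \<phi> n x) \<longlonglongrightarrow> sgn (v x)" if "x \<notin> N" for x
  proof -
    have "(\<lambda>n. max (-1) (min 1 (g n x))) \<longlonglongrightarrow> max (-1) (min 1 (sgn (v x)))"
      by (intro tendsto_intros lim that)
    moreover have "max (-1) (min 1 (sgn (v x))) = sgn (v x)" by (auto simp: sgn_if)
    moreover have "\<forall>\<^sub>F n in sequentially. max (-1) (min 1 (g n x)) = G n x"
    proof -
      obtain k where "norm x \<le> real k" using real_arch_simple by blast
      then have "max (-1) (min 1 (g n x)) = G n x" if "n \<ge> k" for n
        using that by (auto simp: G_def)
      then show ?thesis unfolding eventually_sequentially by blast
    qed
    ultimately have "(\<lambda>n. G n x) \<longlonglongrightarrow> sgn (v x)"
      using Lim_transform_eventually[of "\<lambda>n. max (-1) (min 1 (g n x))"] by simp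
    moreover have "(\<lambda>n. \<phi> n x - G n x) \<longlonglongrightarrow> 0"
      using \<phi>(2) by (intro Lim_null_comparison[OF _ inv0]) auto
    ultimately show ?thesis using tendsto_add[of "\<lambda>n. G n x" "sgn (v x)" _ "\<lambda>n. \<phi> n x - G n x" 0] by simp
  qed
  have [measurable]: "\<phi> n \<in> borel_measurable borel" for n
    by (intro borel_measurable_continuous_onI test_function_continuous \<phi>)
  have "AE x in lebesgue. x \<notin> N"
    using N by (simp add: negligible_iff_null_sets AE_not_in)
  then have "AE x in lborel. x \<notin> N"
    by (simp add: AE_completion_iff)
  then have AE: "AE x in lborel. (\<lambda>n. v x * \<phi> n x) \<longlonglongrightarrow> \<bar>v x\<bar>"
  proof eventually_elim
    case (elim x)
    show ?case using tendsto_mult_left[OF lim\<phi>[OF elim], of "v x"] by (simp add: abs_sgn)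
  qed
  have "(\<lambda>n. LINT x|lborel. v x * \<phi> n x) \<longlonglongrightarrow> (LINT x|lborel. \<bar>v x\<bar>)"
  proof (rule integral_dominated_convergence[where w = "\<lambda>x. 2 * \<bar>v x\<bar>"])
    show "AE x in lborel. norm (v x * \<phi> n x) \<le> 2 * \<bar>v x\<bar>" for n
    proof (rule AE_I2)
      fix x
      have "\<bar>\<phi> n x\<bar> \<le> 2"
        by (rule order_trans[OF bd]) (auto simp: field_simps)
      then show "norm (v x * \<phi> n x) \<le> 2 * \<bar>v x\<bar>"
        by (simp add: abs_mult mult.commute[of 2] mult_left_mono)
    qed
  qed (use v AE in auto)
  moreover have "(\<lambda>n. C * (1 + 1 / (real n + 1))) \<longlonglongrightarrow> C"
    using tendsto_mult[OF tendsto_const tendsto_add[OF tendsto_const inv0], of C 1] by simp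
  moreover have "(LINT x|lborel. v x * \<phi> n x) \<le> C * (1 + 1 / (real n + 1))" for n
    using le[OF \<phi>(1) bd] by (meson abs_le_D1)
  ultimately show ?thesis by (meson LIMSEQ_le)
qed

subsection \<open>Directional differences of BD functions\<close>

lemma
  fixes f :: "'a::euclidean_space \<Rightarrow> 'b::{banach, second_countable_topology}"
  assumes "f \<in> borel_measurable borel"
  shows integrable_translate_iff: "integrable lborel (\<lambda>x. f (x + c)) \<longleftrightarrow> integrable lborel f"
    and integral_translate: "(LINT x|lborel. f (x + c)) = (LINT x|lborel. f x)"
proof -
  have m: "(+) c \<in> lborel \<rightarrow>\<^sub>M borel" by simp
  have "integrable lborel f \<longleftrightarrow> integrable (distr lborel borel ((+) c)) f"
    by (simp only: lborel_distr_plus)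
  also have "\<dots> \<longleftrightarrow> integrable lborel (\<lambda>x. f (x + c))"
    using integrable_distr_eq[OF m assms] by (simp add: add.commute)
  finally show "integrable lborel (\<lambda>x. f (x + c)) \<longleftrightarrow> integrable lborel f" by simp
  have "(LINT x|lborel. f x) = (LINT x|distr lborel borel ((+) c). f x)"
    by (simp only: lborel_distr_plus)
  also have "\<dots> = (LINT x|lborel. f (x + c))"
    using integral_distr[OF m assms] by (simp add: add.commute)
  finally show "(LINT x|lborel. f (x + c)) = (LINT x|lborel. f x)" by simp
qed

lemma nn_integral_translate:
  fixes f :: "'a::euclidean_space \<Rightarrow> ennreal"
  assumes "f \<in> borel_measurable borel"
  shows "(\<integral>\<^sup>+x. f (x + c) \<partial>lborel) = (\<integral>\<^sup>+x. f x \<partial>lborel)"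
proof -
  have m: "(+) c \<in> lborel \<rightarrow>\<^sub>M borel" by simp
  have "(\<integral>\<^sup>+x. f x \<partial>lborel) = (\<integral>\<^sup>+x. f x \<partial>distr lborel borel ((+) c))"
    by (simp only: lborel_distr_plus)
  also have "\<dots> = (\<integral>\<^sup>+x. f (x + c) \<partial>lborel)"
    using nn_integral_distr[OF m, of f] assms by (simp add: add.commute)
  finally show ?thesis by simp
qed

text \<open>Two decompositions P - N = P' - N' of one signed measure are compared in the
  subtraction-free form P + N' = P' + N, which suits \<open>ennreal\<close> and passes from sets to
  nonnegative functions by the usual induction.\<close>

lemma nn_integral_measure_add_eq:
  assumes sets: "sets P = sets M" "sets N = sets M" "sets P' = sets M" "sets N' = sets M"
    and eq: "\<And>B. B \<in> sets M \<Longrightarrow> emeasure P B + emeasure N' B = emeasure P' B + emeasure N B"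
    and g: "g \<in> borel_measurable M"
  shows "(\<integral>\<^sup>+x. g x \<partial>P) + (\<integral>\<^sup>+x. g x \<partial>N') = (\<integral>\<^sup>+x. g x \<partial>P') + (\<integral>\<^sup>+x. g x \<partial>N)"
proof -
  have meas: "h \<in> borel_measurable P" "h \<in> borel_measurable N" "h \<in> borel_measurable P'"
    "h \<in> borel_measurable N'" if "h \<in> borel_measurable M" for h :: "'a \<Rightarrow> ennreal"
    using that by (simp_all only: measurable_cong_sets[OF sets(1) refl] measurable_cong_sets[OF sets(2) refl]
        measurable_cong_sets[OF sets(3) refl] measurable_cong_sets[OF sets(4) refl])
  show ?thesis
    using g
  proof (induction g rule: borel_measurable_induct)
    case (cong f g)
    have sp: "space P = space M" "space N = space M" "space P' = space M" "space N' = space M"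
      using sets sets_eq_imp_space_eq by blast+
    have "(\<integral>\<^sup>+x. f x \<partial>P) = (\<integral>\<^sup>+x. g x \<partial>P)" "(\<integral>\<^sup>+x. f x \<partial>N) = (\<integral>\<^sup>+x. g x \<partial>N)"
      "(\<integral>\<^sup>+x. f x \<partial>P') = (\<integral>\<^sup>+x. g x \<partial>P')" "(\<integral>\<^sup>+x. f x \<partial>N') = (\<integral>\<^sup>+x. g x \<partial>N')"
      using cong sp by (auto intro!: nn_integral_cong)
    then show ?case using cong.IH by (simp only:)
  next
    case (set A)
    then show ?case using eq[OF set] by (simp add: sets)
  next
    case (mult u c)
    show ?case
      using mult.IH by (simp only: nn_integral_cmult meas[OF mult(2)] distrib_left[symmetric])
  next
    case (add u v)
    note m = meas[OF add(1)] meas[OF add(3)]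
    have "(\<integral>\<^sup>+x. v x + u x \<partial>P) + (\<integral>\<^sup>+x. v x + u x \<partial>N')
      = ((\<integral>\<^sup>+x. v x \<partial>P) + (\<integral>\<^sup>+x. v x \<partial>N')) + ((\<integral>\<^sup>+x. u x \<partial>P) + (\<integral>\<^sup>+x. u x \<partial>N'))"
      by (simp only: nn_integral_add m ac_simps)
    also have "\<dots> = (\<integral>\<^sup>+x. v x + u x \<partial>P') + (\<integral>\<^sup>+x. v x + u x \<partial>N)"
      unfolding add.IH by (simp only: nn_integral_add m ac_simps)
    finally show ?case .
  next
    case (seq U)
    note m = meas[OF seq(1)]
    have inc: "incseq (\<lambda>i. \<integral>\<^sup>+x. U i x \<partial>Q)" for Q
      using seq by (auto simp: incseq_def le_fun_def intro!: nn_integral_mono)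
    have S: "(\<integral>\<^sup>+x. (SUP i. U i) x \<partial>Q) = (SUP i. \<integral>\<^sup>+x. U i x \<partial>Q)"
      if "\<And>i. U i \<in> borel_measurable Q" for Q
      using nn_integral_monotone_convergence_SUP[OF seq(3) that]
      by (simp add: SUP_apply image_comp)
    show ?case
      unfolding S[OF m(1)] S[OF m(2)] S[OF m(3)] S[OF m(4)] ennreal_SUP_add[OF inc inc, symmetric] seq.IH ..
  qed
qed

text \<open>The decomposition into positive measures may depend on the integrand; comparing it with
  a fixed one makes the bound uniform.\<close>

lemma has_signed_integral_bound:
  fixes \<mu> :: "(real^'n::finite) set \<Rightarrow> real"
  assumes "has_signed_integral \<mu> f0 I0"
  obtains K where "0 \<le> K"
    "\<And>f I M. has_signed_integral \<mu> f I \<Longrightarrow> f \<in> borel_measurable borel \<Longrightarrow>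
       (\<And>x. \<bar>f x\<bar> \<le> M) \<Longrightarrow> \<bar>I\<bar> \<le> K * M"
proof -
  obtain P0 N0 where fin0: "finite_measure P0" "finite_measure N0"
    and s0: "sets P0 = sets borel" "sets N0 = sets borel"
    and \<mu>0: "\<And>B. B \<in> sets borel \<Longrightarrow> \<mu> B = measure P0 B - measure N0 B"
    using assms unfolding has_signed_integral_def by blast
  interpret P0: finite_measure P0 by fact
  interpret N0: finite_measure N0 by fact
  let ?K = "measure P0 UNIV + measure N0 UNIV"
  show ?thesis
  proof (rule that[of ?K])
    show "0 \<le> ?K" by simp
    fix f :: "real^'n \<Rightarrow> real" and I M
    assume I: "has_signed_integral \<mu> f I" and f: "f \<in> borel_measurable borel"
      and M: "\<And>x. \<bar>f x\<bar> \<le> M"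
    obtain P N where fin: "finite_measure P" "finite_measure N"
      and s: "sets P = sets borel" "sets N = sets borel"
      and \<mu>: "\<And>B. B \<in> sets borel \<Longrightarrow> \<mu> B = measure P B - measure N B"
      and I_eq: "I = (LINT x|P. f x) - (LINT x|N. f x)"
      using I unfolding has_signed_integral_def by blast
    interpret P: finite_measure P by fact
    interpret N: finite_measure N by fact
    have "emeasure P B + emeasure N0 B = emeasure P0 B + emeasure N B" if "B \<in> sets borel" for B
    proof -
      have "measure P B + measure N0 B = measure P0 B + measure N B"
        using \<mu>[OF that] \<mu>0[OF that] by simp
      then show ?thesis
        by (simp add: P.emeasure_eq_measure N.emeasure_eq_measure P0.emeasure_eq_measure
            N0.emeasure_eq_measure flip: ennreal_plus)
    qed
    \<comment> \<open>Shifting by \<open>M\<close> makes the integrand nonnegative, so the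
      comparison of measures applies. The constants added on both sides cancel later because the
      total masses agree.\<close>
    moreover have "(\<lambda>x. ennreal (f x + M)) \<in> borel_measurable borel" using f by simp
    ultimately have *: "(\<integral>\<^sup>+x. ennreal (f x + M) \<partial>P) + (\<integral>\<^sup>+x. ennreal (f x + M) \<partial>N0)
        = (\<integral>\<^sup>+x. ennreal (f x + M) \<partial>P0) + (\<integral>\<^sup>+x. ennreal (f x + M) \<partial>N)"
      by (intro nn_integral_measure_add_eq[where M = borel]) (auto simp: s s0)
    have nonneg: "0 \<le> f x + M" for x using M[of x] by linarith
    have int: "integrable Q f" and nn: "(\<integral>\<^sup>+x. ennreal (f x + M) \<partial>Q)
        = ennreal ((LINT x|Q. f x) + M * measure Q UNIV)"
      and nn0: "0 \<le> (LINT x|Q. f x) + M * measure Q UNIV"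
      if Q: "finite_measure Q" "sets Q = sets borel" for Q
    proof -
      interpret Q: finite_measure Q by fact
      have sp: "space Q = UNIV" using sets_eq_imp_space_eq[OF Q(2)] by simp
      have "f \<in> borel_measurable Q" using f Q(2) by (simp add: measurable_cong_sets[OF Q(2) refl])
      then show int: "integrable Q f" using M by (intro Q.integrable_const_bound[of _ M]) auto
      have e: "(LINT x|Q. f x + M) = (LINT x|Q. f x) + M * measure Q UNIV"
        using int by (simp add: sp mult.commute)
      have i2: "integrable Q (\<lambda>x. f x + M)" using int by auto
      show "(\<integral>\<^sup>+x. ennreal (f x + M) \<partial>Q) = ennreal ((LINT x|Q. f x) + M * measure Q UNIV)"
        unfolding e[symmetric] by (rule nn_integral_eq_integral[OF i2]) (intro AE_I2 nonneg)
      show "0 \<le> (LINT x|Q. f x) + M * measure Q UNIV"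
        unfolding e[symmetric] by (intro Bochner_Integration.integral_nonneg nonneg)
    qed
    have "(LINT x|P. f x) + M * measure P UNIV + ((LINT x|N0. f x) + M * measure N0 UNIV)
      = (LINT x|P0. f x) + M * measure P0 UNIV + ((LINT x|N. f x) + M * measure N UNIV)"
      using * nn0[OF fin(1) s(1)] nn0[OF fin(2) s(2)] nn0[OF fin0(1) s0(1)] nn0[OF fin0(2) s0(2)]
      by (simp add: nn fin fin0 s s0 flip: ennreal_plus)
    moreover have "measure P UNIV + measure N0 UNIV = measure P0 UNIV + measure N UNIV"
      using \<mu>[of UNIV] \<mu>0[of UNIV] by simp
    then have "M * measure P UNIV + M * measure N0 UNIV = M * measure P0 UNIV + M * measure N UNIV"
      by (metis distrib_left)
    ultimately have I0: "I = (LINT x|P0. f x) - (LINT x|N0. f x)"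
      using I_eq by linarith
    have "\<bar>LINT x|Q. f x\<bar> \<le> measure Q UNIV * M" if Q: "finite_measure Q" "sets Q = sets borel" for Q
    proof -
      interpret Q: finite_measure Q by fact
      have sp: "space Q = UNIV" using sets_eq_imp_space_eq[OF Q(2)] by simp
      have "\<bar>LINT x|Q. f x\<bar> \<le> (LINT x|Q. \<bar>f x\<bar>)" by (rule integral_abs_bound)
      also have "\<dots> \<le> (LINT x|Q. M)"
        using int[OF Q] M by (intro integral_mono) auto
      finally show ?thesis by (simp add: sp)
    qed
    from this[OF fin0(1) s0(1)] this[OF fin0(2) s0(2)]
    show "\<bar>I\<bar> \<le> ?K * M" unfolding I0 by (simp add: distrib_right)
  qed
qed

section \<open>Testing the symmetric gradient in a fixed direction\<close>

lemma test_function_frechet_bounded: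
  fixes f :: "real^'n::finite \<Rightarrow> real"
  assumes "test_function f"
  obtains B where "0 \<le> B" "\<And>x. \<bar>frechet_derivative f (at x) \<xi>\<bar> \<le> B"
proof -
  have "\<exists>B. 0 \<le> B \<and> (\<forall>x. \<bar>partial_deriv j f x\<bar> \<le> B)" for j
    using test_function_partial_deriv_bounded[OF assms] by metis
  then obtain B where B: "\<And>j. 0 \<le> B j" "\<And>j x. \<bar>partial_deriv j f x\<bar> \<le> B j" by metis
  have "\<bar>frechet_derivative f (at x) \<xi>\<bar> \<le> (\<Sum>j\<in>UNIV. \<bar>\<xi> $ j\<bar> * B j)" for x
    unfolding frechet_derivative_eq_sum_partial_deriv[OF test_function_differentiable[OF assms]]
    by (rule order_trans[OF sum_abs]) (auto simp: abs_mult intro!: sum_mono mult_left_mono B)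
  then show ?thesis using that[of "\<Sum>j\<in>UNIV. \<bar>\<xi> $ j\<bar> * B j"] B by (simp add: sum_nonneg)
qed

lemma test_function_zero: "test_function (\<lambda>_::real^'n::finite. 0)"
  using test_function_poly_bump[OF real_polynomial_function.intros(2)[of 0]] by simp

text \<open>Contracting the symmetric gradient with \<xi> twice gives the derivative of u \<bullet>
  \<xi> in direction \<xi>. This is the only kind of full derivative that BD controls, and it is
  quadratic in \<xi>.\<close>

lemma BD_directional_bound:
  fixes u :: "real^'n::finite \<Rightarrow> real^'n"
  assumes "u \<in> BD"
  obtains C where "0 \<le> C"
    "\<And>\<phi> M \<xi>. test_function \<phi> \<Longrightarrow> (\<And>x. \<bar>\<phi> x\<bar> \<le> M) \<Longrightarrow>
      \<bar>LINT x|lebesgue. (u x \<bullet> \<xi>) * frechet_derivative \<phi> (at x) \<xi>\<bar> \<le> C * (norm \<xi>)\<^sup>2 * M"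
proof -
  obtain \<mu> :: "(real^'n) set \<Rightarrow> real^'n^'n" where int: "integrable lebesgue u"
    and \<mu>: "\<And>f i j. test_function f \<Longrightarrow>
        has_signed_integral (\<lambda>B. \<mu> B $ i $ j) f (distr_sym_grad u i j f)"
    using assms unfolding BD_def by blast
  \<comment> \<open>The zero function is used to exhibit one decomposition of each entry of the
    measure; \<open>K\<close> is the total mass of that decomposition and serves all test
    functions.\<close>
  have "\<exists>K. 0 \<le> K \<and> (\<forall>f I M. has_signed_integral (\<lambda>B. \<mu> B $ i $ j) f I \<longrightarrow>
     f \<in> borel_measurable borel \<longrightarrow> (\<forall>x. \<bar>f x\<bar> \<le> M) \<longrightarrow> \<bar>I\<bar> \<le> K * M)" for i j
    by (rule has_signed_integral_bound[OF \<mu>[OF test_function_zero, of i j]]) blast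
  then obtain K where K0: "\<And>i j. 0 \<le> K i j"
    and K: "\<And>i j f I M. has_signed_integral (\<lambda>B. \<mu> B $ i $ j) f I \<Longrightarrow>
     f \<in> borel_measurable borel \<Longrightarrow> (\<And>x. \<bar>f x\<bar> \<le> M) \<Longrightarrow> \<bar>I\<bar> \<le> K i j * M" by metis
  let ?C = "\<Sum>i\<in>UNIV. \<Sum>j\<in>UNIV. K i j"
  show ?thesis
  proof (rule that[of ?C])
    show "0 \<le> ?C" by (intro sum_nonneg K0)
    fix \<phi> :: "real^'n \<Rightarrow> real" and M \<xi>
    assume \<phi>: "test_function \<phi>" and M: "\<And>x. \<bar>\<phi> x\<bar> \<le> M"
    have le: "\<bar>distr_sym_grad u i j \<phi>\<bar> \<le> K i j * M" for i j
      using K[OF \<mu>[OF \<phi>] _ M] borel_measurable_continuous_onI[OF test_function_continuous[OF \<phi>]]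
      by blast
    have I: "integrable lebesgue (\<lambda>x. u x $ i * partial_deriv j \<phi> x)" for i j
    proof -
      obtain B where B: "0 \<le> B" "\<And>x. \<bar>partial_deriv j \<phi> x\<bar> \<le> B"
        using test_function_partial_deriv_bounded[OF \<phi>] by metis
      have ui: "integrable lebesgue (\<lambda>x. u x $ i)"
        using integrable_bounded_linear[OF bounded_linear_vec_nth int] .
      have "partial_deriv j \<phi> \<in> borel_measurable lebesgue"
        using borel_measurable_continuous_onI[OF test_function_continuous_partial[OF \<phi>]]
        by (intro measurable_completion) simp
      then have m: "(\<lambda>x. u x $ i * partial_deriv j \<phi> x) \<in> borel_measurable lebesgue"
        using ui by (intro borel_measurable_times) auto
      show ?thesis
      proof (rule Bochner_Integration.integrable_bound[OF _ m])
        show "integrable lebesgue (\<lambda>x. B * (u x $ i))" using ui by simp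
        show "AE x in lebesgue. norm (u x $ i * partial_deriv j \<phi> x) \<le> norm (B * (u x $ i))"
          using B by (auto simp: abs_mult mult.commute[of B] intro!: mult_left_mono)
      qed
    qed
    have "(\<Sum>i\<in>UNIV. \<Sum>j\<in>UNIV. \<xi> $ i * \<xi> $ j * distr_sym_grad u i j \<phi>)
      = (\<Sum>i\<in>UNIV. \<Sum>j\<in>UNIV. LINT x|lebesgue.
          - (1/2) * (\<xi> $ i * \<xi> $ j * (u x $ i * partial_deriv j \<phi> x + u x $ j * partial_deriv i \<phi> x)))"
      unfolding distr_sym_grad_def by (simp add: mult.assoc mult.left_commute)
    also have "\<dots> = (LINT x|lebesgue. (\<Sum>i\<in>UNIV. \<Sum>j\<in>UNIV.
          - (1/2) * (\<xi> $ i * \<xi> $ j * (u x $ i * partial_deriv j \<phi> x + u x $ j * partial_deriv i \<phi> x))))"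
      using I by (simp add: Bochner_Integration.integral_sum del: integral_mult_right_zero)
    also have "\<dots> = (LINT x|lebesgue. - ((u x \<bullet> \<xi>) * frechet_derivative \<phi> (at x) \<xi>))"
    proof (rule Bochner_Integration.integral_cong[OF refl])
      fix x
      have 1: "(\<Sum>i\<in>UNIV. \<Sum>j\<in>UNIV. \<xi> $ i * \<xi> $ j * (u x $ i * partial_deriv j \<phi> x))
        = (u x \<bullet> \<xi>) * frechet_derivative \<phi> (at x) \<xi>"
        unfolding frechet_derivative_eq_sum_partial_deriv[OF test_function_differentiable[OF \<phi>]]
          inner_vec_def sum_product by (simp add: ac_simps)
      \<comment> \<open>The weight \<xi>_i \<xi>_j is symmetric, so exchanging the indices
        identifies the second half of the symmetric gradient with the first; this absorbs the factor
        1/2.\<close>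
      have 2: "(\<Sum>i\<in>UNIV. \<Sum>j\<in>UNIV. \<xi> $ i * \<xi> $ j * (u x $ j * partial_deriv i \<phi> x))
        = (u x \<bullet> \<xi>) * frechet_derivative \<phi> (at x) \<xi>"
        unfolding 1[symmetric] by (subst sum.swap) (simp add: ac_simps)
      show "(\<Sum>i\<in>UNIV. \<Sum>j\<in>UNIV.
          - (1/2) * (\<xi> $ i * \<xi> $ j * (u x $ i * partial_deriv j \<phi> x + u x $ j * partial_deriv i \<phi> x)))
         = - ((u x \<bullet> \<xi>) * frechet_derivative \<phi> (at x) \<xi>)"
        by (simp only: distrib_left sum.distrib sum_distrib_left[symmetric] 1 2)
    qed
    finally have "(LINT x|lebesgue. (u x \<bullet> \<xi>) * frechet_derivative \<phi> (at x) \<xi>)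
       = - (\<Sum>i\<in>UNIV. \<Sum>j\<in>UNIV. \<xi> $ i * \<xi> $ j * distr_sym_grad u i j \<phi>)" by simp
    then have "\<bar>LINT x|lebesgue. (u x \<bullet> \<xi>) * frechet_derivative \<phi> (at x) \<xi>\<bar>
      \<le> (\<Sum>i\<in>UNIV. \<Sum>j\<in>UNIV. \<bar>\<xi> $ i * \<xi> $ j * distr_sym_grad u i j \<phi>\<bar>)"
      by (simp add: order_trans[OF sum_abs sum_mono[OF sum_abs]])
    also have "\<dots> \<le> (\<Sum>i\<in>UNIV. \<Sum>j\<in>UNIV. (norm \<xi>)\<^sup>2 * (K i j * M))"
      unfolding abs_mult power2_eq_square
      by (intro sum_mono mult_mono component_le_norm_cart le mult_nonneg_nonneg) auto
    also have "\<dots> = ?C * (norm \<xi>)\<^sup>2 * M"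
      by (simp add: sum_distrib_left sum_distrib_right ac_simps)
    finally show "\<bar>LINT x|lebesgue. (u x \<bullet> \<xi>) * frechet_derivative \<phi> (at x) \<xi>\<bar> \<le> ?C * (norm \<xi>)\<^sup>2 * M" .
  qed
qed

text \<open>By duality it suffices to test the difference with \<phi>. Moving the translation onto
  \<phi> gives g(1) - g(0), and g'(t) is up to sign the hypothesis applied to a translate of \<phi>,
  which is a test function with the same bound. The mean value inequality concludes.\<close>

lemma difference_L1_bound:
  fixes v :: "real^'n::finite \<Rightarrow> real"
  assumes v: "integrable lborel v"
    and D: "\<And>\<phi> M. test_function \<phi> \<Longrightarrow> (\<And>x. \<bar>\<phi> x\<bar> \<le> M) \<Longrightarrow>
      \<bar>LINT x|lborel. v x * frechet_derivative \<phi> (at x) \<xi>\<bar> \<le> D * M"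
  shows "(LINT x|lborel. \<bar>v (x + \<xi>) - v x\<bar>) \<le> D"
proof (rule L1_norm_le_if_tested)
  have [measurable]: "v \<in> borel_measurable borel" using v by auto
  have vs: "integrable lborel (\<lambda>x. v (x + \<xi>))" using v by (simp add: integrable_translate_iff)
  then show "integrable lborel (\<lambda>x. v (x + \<xi>) - v x)" using v by simp
  fix \<phi> :: "real^'n \<Rightarrow> real" and M
  assume \<phi>: "test_function \<phi>" and M: "\<And>x. \<bar>\<phi> x\<bar> \<le> M"
  have [measurable]: "\<phi> \<in> borel_measurable borel"
    by (intro borel_measurable_continuous_onI test_function_continuous \<phi>)
  obtain L where L: "0 \<le> L" "\<And>x. \<bar>frechet_derivative \<phi> (at x) \<xi>\<bar> \<le> L"
    using test_function_frechet_bounded[OF \<phi>] by metis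
  define g where "g t = (LINT x|lborel. v x * \<phi> (x - t *\<^sub>R \<xi>))" for t
  define g' where "g' t = (LINT x|lborel. v x * frechet_derivative \<phi> (at (x - t *\<^sub>R \<xi>)) \<xi>)" for t
  have int: "integrable lborel (\<lambda>x. w x * \<phi> (x - t *\<^sub>R \<xi>))" if w: "integrable lborel w" for t w
  proof (rule Bochner_Integration.integrable_bound[of _ "\<lambda>x. M * w x"])
    show "AE x in lborel. norm (w x * \<phi> (x - t *\<^sub>R \<xi>)) \<le> norm (M * w x)"
    proof (rule AE_I2)
      fix x
      have "\<bar>\<phi> (x - t *\<^sub>R \<xi>)\<bar> \<le> \<bar>M\<bar>" using M[of "x - t *\<^sub>R \<xi>"] by linarith
      then show "norm (w x * \<phi> (x - t *\<^sub>R \<xi>)) \<le> norm (M * w x)"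
        by (simp add: abs_mult mult.commute[of "\<bar>M\<bar>"] mult_left_mono)
    qed
  qed (use w in auto)
  have der: "((\<lambda>t. \<phi> (x - t *\<^sub>R \<xi>)) has_real_derivative
      - frechet_derivative \<phi> (at (x - t *\<^sub>R \<xi>)) \<xi>) (at t)" for x t
  proof -
    have d: "(\<phi> has_derivative frechet_derivative \<phi> (at (x - t *\<^sub>R \<xi>))) (at (x - t *\<^sub>R \<xi>))"
      using test_function_differentiable[OF \<phi>] by (simp add: frechet_derivative_works)
    have "((\<lambda>t. x - t *\<^sub>R \<xi>) has_derivative (\<lambda>h. - (h *\<^sub>R \<xi>))) (at t)"
      by (auto intro!: derivative_eq_intros)
    from has_derivative_compose[OF this d]
    have "((\<lambda>t. \<phi> (x - t *\<^sub>R \<xi>)) has_derivative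
      (\<lambda>h. frechet_derivative \<phi> (at (x - t *\<^sub>R \<xi>)) (- (h *\<^sub>R \<xi>)))) (at t)" .
    moreover have "(\<lambda>h. frechet_derivative \<phi> (at (x - t *\<^sub>R \<xi>)) (- (h *\<^sub>R \<xi>)))
       = (*) (- frechet_derivative \<phi> (at (x - t *\<^sub>R \<xi>)) \<xi>)"
    proof -
      interpret bounded_linear "frechet_derivative \<phi> (at (x - t *\<^sub>R \<xi>))"
        using d has_derivative_bounded_linear by blast
      show ?thesis by (auto simp: neg scaleR)
    qed
    ultimately show ?thesis by (simp add: has_field_derivative_def)
  qed
  have lip: "\<bar>\<phi> (x - s *\<^sub>R \<xi>) - \<phi> (x - t *\<^sub>R \<xi>)\<bar> \<le> L * \<bar>s - t\<bar>" for x s t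
    using field_differentiable_bound[of UNIV "\<lambda>t. \<phi> (x - t *\<^sub>R \<xi>)"
        "\<lambda>t. - frechet_derivative \<phi> (at (x - t *\<^sub>R \<xi>)) \<xi>" L s t] der L by auto
  \<comment> \<open>Differentiation under the integral: along any sequence tending to t, the
    difference quotients of \<phi> are bounded by \<open>L\<close>, so
    \<open>L * \<bar>v x\<bar>\<close> is an integrable majorant.\<close>
  have dg: "(g has_real_derivative - g' t) (at t)" for t
    unfolding has_field_derivative_iff tendsto_at_iff_sequentially
  proof (intro allI impI)
    fix X :: "nat \<Rightarrow> real"
    assume X: "\<forall>i. X i \<in> UNIV - {t}" "X \<longlonglongrightarrow> t"
    let ?q = "\<lambda>n x. v x * ((\<phi> (x - X n *\<^sub>R \<xi>) - \<phi> (x - t *\<^sub>R \<xi>)) / (X n - t))"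
    have "(\<lambda>n. LINT x|lborel. ?q n x)
       \<longlonglongrightarrow> (LINT x|lborel. v x * - frechet_derivative \<phi> (at (x - t *\<^sub>R \<xi>)) \<xi>)"
    proof (rule integral_dominated_convergence[where w = "\<lambda>x. L * \<bar>v x\<bar>"])
      show lim: "AE x in lborel. (\<lambda>n. ?q n x) \<longlonglongrightarrow> v x * - frechet_derivative \<phi> (at (x - t *\<^sub>R \<xi>)) \<xi>"
      proof (intro AE_I2 tendsto_mult_left)
        fix x
        show "(\<lambda>n. (\<phi> (x - X n *\<^sub>R \<xi>) - \<phi> (x - t *\<^sub>R \<xi>)) / (X n - t))
          \<longlonglongrightarrow> - frechet_derivative \<phi> (at (x - t *\<^sub>R \<xi>)) \<xi>"
          using der[of x t] X unfolding has_field_derivative_iff tendsto_at_iff_sequentially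
          by (auto simp: o_def)
      qed
      have "(\<lambda>x. frechet_derivative \<phi> (at (x - t *\<^sub>R \<xi>)) \<xi>) \<in> borel_measurable lborel"
        unfolding frechet_derivative_eq_sum_partial_deriv[OF test_function_differentiable[OF \<phi>]]
      proof (intro borel_measurable_sum borel_measurable_times borel_measurable_const)
        fix j
        have [measurable]: "partial_deriv j \<phi> \<in> borel_measurable borel"
          by (intro borel_measurable_continuous_onI test_function_continuous_partial \<phi>)
        show "(\<lambda>x. partial_deriv j \<phi> (x - t *\<^sub>R \<xi>)) \<in> borel_measurable lborel" by measurable
      qed
      then show "(\<lambda>x. v x * - frechet_derivative \<phi> (at (x - t *\<^sub>R \<xi>)) \<xi>) \<in> borel_measurable lborel"
        by measurable
      show "?q n \<in> borel_measurable lborel" for n by measurable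
      show "integrable lborel (\<lambda>x. L * \<bar>v x\<bar>)" using v by simp
      show "AE x in lborel. norm (?q n x) \<le> L * \<bar>v x\<bar>" for n
      proof (rule AE_I2)
        fix x
        have "X n - t \<noteq> 0" using X(1) by auto
        then have "\<bar>(\<phi> (x - X n *\<^sub>R \<xi>) - \<phi> (x - t *\<^sub>R \<xi>)) / (X n - t)\<bar> \<le> L"
          using lip[of x "X n" t] by (simp add: abs_divide divide_le_eq)
        then show "norm (?q n x) \<le> L * \<bar>v x\<bar>"
          unfolding real_norm_def abs_mult mult.commute[of L] by (intro mult_left_mono) auto
      qed
    qed
    moreover have e: "(LINT x|lborel. ?q n x) = (g (X n) - g t) / (X n - t)" for n
    proof -
      have "(LINT x|lborel. ?q n x)
        = (LINT x|lborel. (v x * \<phi> (x - X n *\<^sub>R \<xi>) - v x * \<phi> (x - t *\<^sub>R \<xi>)) / (X n - t))"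
        by (simp add: algebra_simps)
      also have "\<dots> = (g (X n) - g t) / (X n - t)"
        using int[OF v] by (simp add: g_def)
      finally show ?thesis .
    qed
    ultimately show "((\<lambda>y. (g y - g t) / (y - t)) \<circ> X) \<longlonglongrightarrow> - g' t"
      unfolding e by (simp add: o_def g'_def)
  qed
  have g'b: "\<bar>g' t\<bar> \<le> D * M" for t
  proof -
    have "frechet_derivative (\<lambda>x. \<phi> (x - t *\<^sub>R \<xi>)) (at x) = frechet_derivative \<phi> (at (x - t *\<^sub>R \<xi>))" for x
    proof -
      have "(\<phi> has_derivative frechet_derivative \<phi> (at (x - t *\<^sub>R \<xi>))) (at (x - t *\<^sub>R \<xi>))"
        using test_function_differentiable[OF \<phi>] by (simp add: frechet_derivative_works)
      moreover have "((\<lambda>x. x - t *\<^sub>R \<xi>) has_derivative (\<lambda>h. h)) (at x)"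
        by (auto intro!: derivative_eq_intros)
      ultimately have "((\<lambda>x. \<phi> (x - t *\<^sub>R \<xi>)) has_derivative frechet_derivative \<phi> (at (x - t *\<^sub>R \<xi>))) (at x)"
        using has_derivative_compose by blast
      then show ?thesis by (metis frechet_derivative_at)
    qed
    then show ?thesis
      using D[OF test_function_translate[OF \<phi>, of "t *\<^sub>R \<xi>"], of M] M by (simp add: g'_def)
  qed
  have "\<bar>g 1 - g 0\<bar> \<le> D * M * \<bar>1 - 0\<bar>"
    using field_differentiable_bound[of UNIV g "\<lambda>t. - g' t" "D * M" 1 0] dg g'b by auto
  moreover have "(LINT x|lborel. (v (x + \<xi>) - v x) * \<phi> x) = g 1 - g 0"
  proof -
    have "(LINT x|lborel. v (x + \<xi>) * \<phi> x) = g 1"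
      using integral_translate[of "\<lambda>x. v x * \<phi> (x - \<xi>)" \<xi>] by (simp add: g_def)
    moreover have "integrable lborel (\<lambda>x. v (x + \<xi>) * \<phi> x)" "integrable lborel (\<lambda>x. v x * \<phi> x)"
      using int[OF vs, of 0] int[OF v, of 0] by auto
    ultimately show ?thesis by (simp add: left_diff_distrib g_def)
  qed
  ultimately show "\<bar>LINT x|lborel. (v (x + \<xi>) - v x) * \<phi> x\<bar> \<le> D * M" by simp
qed

subsection \<open>The modulus of continuity in the mean\<close>

definition l1 :: "('a::euclidean_space \<Rightarrow> real) \<Rightarrow> real"
  where "l1 f = (LINT x|lborel. \<bar>f x\<bar>)"

lemma l1_le_add:
  assumes "integrable lborel f" "integrable lborel g" "integrable lborel h"
    and "\<And>x. \<bar>f x\<bar> \<le> \<bar>g x\<bar> + \<bar>h x\<bar>"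
  shows "l1 f \<le> l1 g + l1 h"
proof -
  have "l1 f \<le> (LINT x|lborel. \<bar>g x\<bar> + \<bar>h x\<bar>)"
    unfolding l1_def using assms by (intro integral_mono) auto
  then show ?thesis using assms by (simp add: l1_def)
qed

lemma l1_cmult: "l1 (\<lambda>x. c * f x) = \<bar>c\<bar> * l1 f"
  by (simp add: l1_def abs_mult)

lemma l1_translate: "integrable lborel f \<Longrightarrow> l1 (\<lambda>x. f (x + c)) = l1 f"
  unfolding l1_def by (rule integral_translate[where f = "\<lambda>x. \<bar>f x\<bar>"]) auto

lemma l1_nonneg: "0 \<le> l1 f"
  by (simp add: l1_def)

lemma norm_axis: "norm (axis i s :: real^'n::finite) = \<bar>s\<bar>"
  by (simp add: norm_eq_sqrt_inner inner_axis_axis)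

lemma integrable_component_difference:
  fixes u :: "real^'n::finite \<Rightarrow> real^'m::finite"
  assumes "integrable lborel u"
  shows "integrable lborel (\<lambda>x. u (x + h) $ i - u x $ i)"
proof -
  have "integrable lborel (\<lambda>x. u (x + h))" using assms by (simp add: integrable_translate_iff)
  then show ?thesis
    using integrable_bounded_linear[OF bounded_linear_vec_nth] assms
    by (intro Bochner_Integration.integrable_diff) blast+
qed

text \<open>Along \<open>t e_i + s e_j\<close> only \<open>t \<Delta>\<^bsub>s e_j\<^esub> u_i + s \<Delta>\<^bsub>t e_i\<^esub> u_j\<close> is controlled;
  comparing \<open>s = t\<close> with \<open>s = 2 t\<close> eliminates \<open>u_j\<close>.\<close>

lemma l1_difference_doubling:
  fixes u :: "real^'n::finite \<Rightarrow> real^'n"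
  assumes u: "integrable lborel u"
    and C: "\<And>\<xi>. l1 (\<lambda>x. (u (x + \<xi>) - u x) \<bullet> \<xi>) \<le> C * (norm \<xi>)\<^sup>2"
    and t: "0 < t"
  shows "l1 (\<lambda>x. u (x + axis j t) $ i - u x $ i)
    \<le> l1 (\<lambda>x. u (x + axis j (2 * t)) $ i - u x $ i) / 2 + 9 * C * t"
proof -
  define D where "D k h x = u (x + h) $ k - u x $ k" for k h x
  have intD: "integrable lborel (D k h)" for k h
    unfolding D_def by (rule integrable_component_difference[OF u])
  have intDt: "integrable lborel (\<lambda>x. D k h (x + c))" for k h c
    using intD[of k h] by (subst integrable_translate_iff) auto
  have ax: "l1 (D k (axis k s)) * s \<le> C * s\<^sup>2" if "0 < s" for k s
  proof -
    have "(\<lambda>x. (u (x + axis k s) - u x) \<bullet> axis k s) = (\<lambda>x. s * D k (axis k s) x)"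
      by (auto simp: D_def inner_axis mult.commute)
    then show ?thesis using C[of "axis k s"] that by (simp add: l1_cmult norm_axis mult.commute)
  qed
  have C0: "0 \<le> C"
    using order_trans[OF l1_nonneg C[of "axis i 1"]] by (simp add: norm_axis)
  show ?thesis
  proof (cases "i = j")
    case True
    have "l1 (D i (axis i t)) \<le> C * t"
      using ax[OF t, of i] t by (simp add: power2_eq_square)
    moreover have "C * t \<le> 9 * C * t" using C0 t by simp
    moreover have "0 \<le> l1 (D i (axis i (2 * t)))" by (rule l1_nonneg)
    ultimately show ?thesis using True by (simp add: D_def[abs_def])
  next
    case False
    let ?G = "D j (axis i t)"
    \<comment> \<open>For component i the path to x + t e_i + s e_j goes first along e_j, for
      component j first along e_i. The second legs are then differences of a component in its own
      direction, already bounded by \<open>ax\<close>; removing them costs C t^2 + C s^2.\<close>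
    have sym: "l1 (\<lambda>x. t * D i (axis j s) x + s * ?G x) \<le> 2 * C * (t\<^sup>2 + s\<^sup>2)" if s: "0 < s" for s
    proof -
      let ?\<xi> = "axis i t + axis j s"
      let ?A = "\<lambda>x. t * D i ?\<xi> x + s * D j ?\<xi> x"
      let ?B1 = "\<lambda>x. t * D i (axis i t) (x + axis j s)"
      let ?B2 = "\<lambda>x. s * D j (axis j s) (x + axis i t)"
      have n: "(norm ?\<xi>)\<^sup>2 = t\<^sup>2 + s\<^sup>2"
        using False by (simp only: power2_norm_eq_inner) (simp add: inner_add inner_axis_axis power2_eq_square)
      have "(\<lambda>x. (u (x + ?\<xi>) - u x) \<bullet> ?\<xi>) = ?A"
        by (auto simp: D_def inner_add_right inner_axis mult.commute)
      then have A: "l1 ?A \<le> C * (t\<^sup>2 + s\<^sup>2)" using C[of ?\<xi>] n by simp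
      have B1: "l1 ?B1 \<le> C * t\<^sup>2"
        using ax[OF t, of i] t l1_translate[OF intD, of i "axis i t" "axis j s"]
        by (simp add: l1_cmult mult.commute)
      have B2: "l1 ?B2 \<le> C * s\<^sup>2"
        using ax[OF s, of j] s l1_translate[OF intD, of j "axis j s" "axis i t"]
        by (simp add: l1_cmult mult.commute)
      have iA: "integrable lborel ?A" and iB: "integrable lborel ?B1" "integrable lborel ?B2"
        using intD intDt by auto
      have "l1 (\<lambda>x. t * D i (axis j s) x + s * ?G x) \<le> l1 ?A + l1 (\<lambda>x. ?B1 x + ?B2 x)"
      proof (rule l1_le_add)
        fix x
        have "t * D i (axis j s) x + s * ?G x = ?A x - (?B1 x + ?B2 x)"
          by (simp add: D_def algebra_simps)
        then show "\<bar>t * D i (axis j s) x + s * ?G x\<bar> \<le> \<bar>?A x\<bar> + \<bar>?B1 x + ?B2 x\<bar>"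
          by (simp only: abs_triangle_ineq4)
      qed (use iA iB intD in auto)
      also have "l1 (\<lambda>x. ?B1 x + ?B2 x) \<le> l1 ?B1 + l1 ?B2"
        using iB by (intro l1_le_add) auto
      finally show ?thesis using A B1 B2 by (simp add: algebra_simps)
    qed
    let ?F = "\<lambda>s. D i (axis j s)"
    let ?E = "\<lambda>s x. t * ?F s x + s * ?G x"
    \<comment> \<open>In \<open>2 * ?E t x - ?E (2 * t) x\<close> the multiples of \<open>?G\<close>
      cancel. Its norm is at most 2 * 4 C t^2 + 10 C t^2 = 18 C t^2, and division by 2 t yields the
      constant 9.\<close>
    have "l1 (\<lambda>x. (2 * t) * ?F t x) \<le> l1 (\<lambda>x. t * ?F (2 * t) x) + l1 (\<lambda>x. 2 * ?E t x - ?E (2 * t) x)"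
    proof (rule l1_le_add)
      fix x
      have "2 * t * ?F t x = t * ?F (2 * t) x + (2 * ?E t x - ?E (2 * t) x)"
        by (simp add: algebra_simps)
      then show "\<bar>2 * t * ?F t x\<bar> \<le> \<bar>t * ?F (2 * t) x\<bar> + \<bar>2 * ?E t x - ?E (2 * t) x\<bar>"
        by (simp only: abs_triangle_ineq)
    qed (use intD in auto)
    also have "l1 (\<lambda>x. 2 * ?E t x - ?E (2 * t) x) \<le> l1 (\<lambda>x. 2 * ?E t x) + l1 (?E (2 * t))"
    proof (rule l1_le_add)
      fix x show "\<bar>2 * ?E t x - ?E (2 * t) x\<bar> \<le> \<bar>2 * ?E t x\<bar> + \<bar>?E (2 * t) x\<bar>"
        by (rule abs_triangle_ineq4)
    qed (use intD in auto)
    also have "l1 (\<lambda>x. 2 * ?E t x) = 2 * l1 (?E t)" by (simp only: l1_cmult abs_numeral)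
    finally have "2 * t * l1 (?F t) \<le> t * l1 (?F (2 * t)) + 18 * C * t\<^sup>2"
      using sym[of t] sym[of "2 * t"] t by (simp add: l1_cmult power2_eq_square)
    then have "t * (2 * l1 (?F t)) \<le> t * (l1 (?F (2 * t)) + 18 * C * t)"
      by (simp add: power2_eq_square algebra_simps)
    then have "2 * l1 (?F t) \<le> l1 (?F (2 * t)) + 18 * C * t" using t by simp
    then show ?thesis by (simp add: D_def[abs_def])
  qed
qed

text \<open>With c = 2^(\<sigma> - 1), halving the bound K (2 t)^\<sigma> gives K c t^\<sigma>. As
  \<sigma> < 1, c is below 1, and the remaining K (1 - c) t^\<sigma> absorbs b t on t \<le> 1. The
  bound therefore descends from one dyadic scale to the next with the same \<open>K\<close>.\<close>

lemma powr_bound_if_doubling: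
  fixes f :: "real \<Rightarrow> real"
  assumes \<sigma>: "0 < \<sigma>" "\<sigma> < 1" and b: "0 \<le> b" and A: "\<And>t. f t \<le> A" "0 \<le> A"
    and rec: "\<And>t. 0 < t \<Longrightarrow> f t \<le> f (2 * t) / 2 + b * t"
  obtains K where "0 \<le> K" "\<And>t. 0 < t \<Longrightarrow> t \<le> 1 \<Longrightarrow> f t \<le> K * t powr \<sigma>"
proof -
  define c where "c = 2 powr (\<sigma> - 1)"
  have c: "c < 1" unfolding c_def using powr_less_mono[of "\<sigma> - 1" 0 2] \<sigma> by simp
  \<comment> \<open>The first summand starts the induction on 1/2 < t \<le> 1, where t^\<sigma>
    \<ge> 1/2; the second makes b \<le> K (1 - c).\<close>
  define K where "K = 2 * A + b / (1 - c)"
  have K0: "0 \<le> K" and KA: "2 * A \<le> K" using A b c by (auto simp: K_def)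
  have Kb: "b \<le> K * (1 - c)" using A c by (simp add: K_def distrib_right)
  have tp: "t \<le> t powr \<sigma>" if "0 < t" "t \<le> 1" for t
    using powr_mono'[of \<sigma> 1 t] \<sigma> that by simp
  have base: "f t \<le> K * t powr \<sigma>" if "1/2 < t" "t \<le> 1" for t
  proof -
    have "f t \<le> 2 * A * (1/2)" using A by simp
    also have "\<dots> \<le> K * t powr \<sigma>"
      using that tp[of t] KA K0 A by (intro mult_mono) auto
    finally show ?thesis .
  qed
  have "f t \<le> K * t powr \<sigma>" if "(1/2) ^ k < t" "t \<le> 1" for k t
    using that
  proof (induction k arbitrary: t)
    case 0
    then show ?case by simp
  next
    case (Suc k)
    have t0: "0 < t" using less_trans[OF _ Suc.prems(1), of 0] by simp
    show ?case
    proof (cases "1/2 < t")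
      case True
      then show ?thesis using base Suc.prems by blast
    next
      case False
      then have "f (2 * t) \<le> K * (2 * t) powr \<sigma>"
        using Suc.prems by (intro Suc.IH) auto
      moreover have "(2 * t) powr \<sigma> = 2 * c * t powr \<sigma>"
        using t0 by (simp add: c_def powr_mult powr_diff)
      ultimately have "f t \<le> K * c * t powr \<sigma> + b * t"
        using rec[OF t0] by simp
      also have "b * t \<le> b * t powr \<sigma>" using tp t0 Suc.prems b by (intro mult_left_mono) auto
      also have "b * t powr \<sigma> \<le> K * (1 - c) * t powr \<sigma>" using Kb by (intro mult_right_mono) auto
      finally show ?thesis by (simp add: algebra_simps)
    qed
  qed
  moreover have "\<exists>k. (1/2) ^ k < t" if "0 < t" for t :: real
    using real_arch_pow_inv[of t "1/2"] that by simp
  ultimately have "f t \<le> K * t powr \<sigma>" if "0 < t" "t \<le> 1" for t using that by blast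
  then show ?thesis using that K0 by blast
qed

lemma l1_axis_difference_bound:
  fixes u :: "real^'n::finite \<Rightarrow> real^'n"
  assumes u: "integrable lborel u"
    and C: "\<And>\<xi>. l1 (\<lambda>x. (u (x + \<xi>) - u x) \<bullet> \<xi>) \<le> C * (norm \<xi>)\<^sup>2"
    and \<sigma>: "0 < \<sigma>" "\<sigma> < 1"
  obtains K where "0 \<le> K"
    "\<And>t. \<bar>t\<bar> \<le> 1 \<Longrightarrow> l1 (\<lambda>x. u (x + axis j t) $ i - u x $ i) \<le> K * \<bar>t\<bar> powr \<sigma>"
proof -
  let ?D = "\<lambda>t x. u (x + axis j t) $ i - u x $ i"
  have ui: "integrable lborel (\<lambda>x. u x $ i)"
    using integrable_bounded_linear[OF bounded_linear_vec_nth u] .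
  then have uit: "integrable lborel (\<lambda>x. u (x + c) $ i)" for c
    by (subst integrable_translate_iff) auto
  have A: "l1 (?D t) \<le> 2 * l1 (\<lambda>x. u x $ i)" for t
  proof -
    have "l1 (?D t) \<le> l1 (\<lambda>x. u (x + axis j t) $ i) + l1 (\<lambda>x. u x $ i)"
      using ui uit by (intro l1_le_add) auto
    then show ?thesis using l1_translate[OF ui] by simp
  qed
  have C0: "0 \<le> C"
    using order_trans[OF l1_nonneg C[of "axis i 1"]] by (simp add: norm_axis)
  obtain K where K: "0 \<le> K" "\<And>t. 0 < t \<Longrightarrow> t \<le> 1 \<Longrightarrow> l1 (?D t) \<le> K * t powr \<sigma>"
    by (rule powr_bound_if_doubling[OF \<sigma>, of "9 * C" "\<lambda>t. l1 (?D t)" "2 * l1 (\<lambda>x. u x $ i)"])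
       (use A C0 l1_nonneg l1_difference_doubling[OF u C] in auto)
  have "l1 (?D t) \<le> K * \<bar>t\<bar> powr \<sigma>" if "\<bar>t\<bar> \<le> 1" for t
  proof -
    consider "t = 0" | "0 < t" | "t < 0" by linarith
    then show ?thesis
    proof cases
      case 1
      have "axis j 0 = (0::real^'n)" by (simp add: axis_def vec_eq_iff)
      then show ?thesis unfolding 1 by (simp only:) (simp add: l1_def)
    next
      case 2
      then show ?thesis using K(2)[of t] that by simp
    next
      case 3
      have ax: "axis j t + axis j (- t) = (0::real^'n)" by (simp add: axis_def vec_eq_iff)
      \<comment> \<open>The difference with step t, translated by - t, is the negative of the
        difference with step - t, so negative steps reduce to positive ones.\<close>
      have "l1 (?D t) = l1 (\<lambda>x. ?D t (x + axis j (- t)))"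
        by (rule l1_translate[symmetric]) (rule integrable_component_difference[OF u])
      also have "\<dots> = l1 (?D (- t))"
        unfolding l1_def using ax by (simp add: add.assoc add.commute[of "axis j (- t)"] abs_minus_commute)
      finally show ?thesis using K(2)[of "- t"] that 3 by simp
    qed
  qed
  then show ?thesis using that K(1) by blast
qed

lemma L1_modulus_of_continuity:
  fixes u :: "real^'n::finite \<Rightarrow> real^'n"
  assumes u: "integrable lborel u"
    and C: "\<And>\<xi>. l1 (\<lambda>x. (u (x + \<xi>) - u x) \<bullet> \<xi>) \<le> C * (norm \<xi>)\<^sup>2"
    and \<sigma>: "0 < \<sigma>" "\<sigma> < 1"
  obtains K where "0 \<le> K"
    "\<And>h. norm h \<le> 1 \<Longrightarrow> (LINT x|lborel. norm (u (x + h) - u x)) \<le> K * norm h powr \<sigma>"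
proof -
  define E where "E i j t = l1 (\<lambda>x. u (x + axis j t) $ i - u x $ i)" for i j t
  have "\<exists>K. 0 \<le> K \<and> (\<forall>t. \<bar>t\<bar> \<le> 1 \<longrightarrow> E i j t \<le> K * \<bar>t\<bar> powr \<sigma>)" for i j
    unfolding E_def by (rule l1_axis_difference_bound[OF u C \<sigma>, of j i]) auto
  then obtain K where K0: "\<And>i j. 0 \<le> K i j"
    and KE: "\<And>i j t. \<bar>t\<bar> \<le> 1 \<Longrightarrow> E i j t \<le> K i j * \<bar>t\<bar> powr \<sigma>"
    by metis
  note K = KE[unfolded E_def]
  have comp: "l1 (\<lambda>x. u (x + h) $ i - u x $ i) \<le> (\<Sum>j\<in>UNIV. K i j * \<bar>h $ j\<bar> powr \<sigma>)"
    if h: "norm h \<le> 1" for h i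
  proof -
    have hj: "\<bar>h $ j\<bar> \<le> 1" for j using component_le_norm_cart[of h j] h by linarith
    \<comment> \<open>The step h is taken one coordinate at a time. Each new leg starts at a shifted
      point, which translation invariance of the norm makes irrelevant.\<close>
    have "l1 (\<lambda>x. u (x + (\<Sum>j\<in>S. axis j (h $ j))) $ i - u x $ i) \<le> (\<Sum>j\<in>S. K i j * \<bar>h $ j\<bar> powr \<sigma>)"
      if "finite S" for S
      using that
    proof induction
      case empty
      then show ?case by (simp add: l1_def)
    next
      case (insert j S)
      let ?y = "\<Sum>j\<in>S. axis j (h $ j)"
      let ?d = "\<lambda>c x. u (x + c) $ i - u x $ i"
      have int: "integrable lborel (?d c)" for c by (rule integrable_component_difference[OF u])
      have int': "integrable lborel (\<lambda>x. ?d c (x + z))" for c z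
        using int[of c] by (subst integrable_translate_iff) auto
      have "l1 (?d (axis j (h $ j) + ?y)) \<le> l1 (\<lambda>x. ?d (axis j (h $ j)) (x + ?y)) + l1 (?d ?y)"
      proof (rule l1_le_add[OF int int' int])
        fix x
        have "x + (axis j (h $ j) + ?y) = x + ?y + axis j (h $ j)" by (simp add: add_ac)
        then have "?d (axis j (h $ j) + ?y) x = ?d (axis j (h $ j)) (x + ?y) + ?d ?y x"
          by (simp only:)
        then show "\<bar>?d (axis j (h $ j) + ?y) x\<bar> \<le> \<bar>?d (axis j (h $ j)) (x + ?y)\<bar> + \<bar>?d ?y x\<bar>"
          by (simp only: abs_triangle_ineq)
      qed
      also have "l1 (\<lambda>x. ?d (axis j (h $ j)) (x + ?y)) = l1 (?d (axis j (h $ j)))"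
        by (rule l1_translate[OF int])
      finally show ?case using insert K[OF hj[of j], where i = i and j = j] by simp
    qed
    from this[of UNIV] show ?thesis
    proof -
      have "(\<Sum>j\<in>UNIV. axis j (h $ j)) = h"
        by (simp add: vec_eq_iff axis_def if_distrib cong: if_cong)
      then show ?thesis using \<open>finite UNIV \<Longrightarrow> _\<close> by simp
    qed
  qed
  show ?thesis
  proof (rule that[of "\<Sum>i\<in>UNIV. \<Sum>j\<in>UNIV. K i j"])
    show "0 \<le> (\<Sum>i\<in>UNIV. \<Sum>j\<in>UNIV. K i j)" by (intro sum_nonneg K0)
    fix h :: "real^'n" assume h: "norm h \<le> 1"
    have int: "integrable lborel (\<lambda>x. u (x + h) $ i - u x $ i)" for i
      by (rule integrable_component_difference[OF u])
    have "integrable lborel (\<lambda>x. u (x + h))" using u by (simp add: integrable_translate_iff)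
    then have "(LINT x|lborel. norm (u (x + h) - u x))
       \<le> (LINT x|lborel. (\<Sum>i\<in>UNIV. \<bar>u (x + h) $ i - u x $ i\<bar>))"
      using u int by (intro integral_mono) (auto intro!: order_trans[OF norm_le_l1_cart])
    also have "\<dots> = (\<Sum>i\<in>UNIV. l1 (\<lambda>x. u (x + h) $ i - u x $ i))"
      using int by (simp add: l1_def Bochner_Integration.integral_sum)
    also have "\<dots> \<le> (\<Sum>i\<in>UNIV. \<Sum>j\<in>UNIV. K i j * \<bar>h $ j\<bar> powr \<sigma>)"
      by (intro sum_mono comp h)
    also have "\<dots> \<le> (\<Sum>i\<in>UNIV. \<Sum>j\<in>UNIV. K i j * norm h powr \<sigma>)"
      using \<sigma> component_le_norm_cart
      by (intro sum_mono mult_left_mono K0 powr_mono2) auto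
    finally show "(LINT x|lborel. norm (u (x + h) - u x)) \<le> (\<Sum>i\<in>UNIV. \<Sum>j\<in>UNIV. K i j) * norm h powr \<sigma>"
      by (simp add: sum_distrib_right)
  qed
qed

lemma BD_L1_modulus:
  fixes u u' :: "real^'n::finite \<Rightarrow> real^'n"
  assumes "u \<in> BD" and u': "u' \<in> borel_measurable borel" and ae: "AE x in lborel. u x = u' x"
    and \<sigma>: "0 < \<sigma>" "\<sigma> < 1"
  obtains K where "0 \<le> K"
    "\<And>h. norm h \<le> 1 \<Longrightarrow> (LINT x|lborel. norm (u' (x + h) - u' x)) \<le> K * norm h powr \<sigma>"
proof -
  have ae': "AE x in lebesgue. u x = u' x" using ae by (simp add: AE_completion_iff)
  have u'leb: "u' \<in> borel_measurable lebesgue" using u' by (intro measurable_completion) simp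
  have "integrable lebesgue u" using \<open>u \<in> BD\<close> by (simp add: BD_def)
  then have "integrable lebesgue u'"
    using integrable_cong_AE[OF _ u'leb ae'] by auto
  then have int: "integrable lborel u'" using u' by (simp add: integrable_completion)
  obtain C where C0: "0 \<le> C"
    and C: "\<And>\<phi> M \<xi>. test_function \<phi> \<Longrightarrow> (\<And>x. \<bar>\<phi> x\<bar> \<le> M) \<Longrightarrow>
      \<bar>LINT x|lebesgue. (u x \<bullet> \<xi>) * frechet_derivative \<phi> (at x) \<xi>\<bar> \<le> C * (norm \<xi>)\<^sup>2 * M"
    by (rule BD_directional_bound[OF \<open>u \<in> BD\<close>]) blast
  have "l1 (\<lambda>x. (u' (x + \<xi>) - u' x) \<bullet> \<xi>) \<le> C * (norm \<xi>)\<^sup>2" for \<xi>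
  proof -
    have "(LINT x|lborel. \<bar>u' (x + \<xi>) \<bullet> \<xi> - u' x \<bullet> \<xi>\<bar>) \<le> C * (norm \<xi>)\<^sup>2"
    proof (rule difference_L1_bound)
      show "integrable lborel (\<lambda>x. u' x \<bullet> \<xi>)" using int by simp
      fix \<phi> :: "real^'n \<Rightarrow> real" and M assume \<phi>: "test_function \<phi>" and M: "\<And>x. \<bar>\<phi> x\<bar> \<le> M"
      have [measurable]: "partial_deriv j \<phi> \<in> borel_measurable borel" for j
        by (intro borel_measurable_continuous_onI test_function_continuous_partial \<phi>)
      have m: "(\<lambda>x. (u' x \<bullet> \<xi>) * frechet_derivative \<phi> (at x) \<xi>) \<in> borel_measurable lborel"
        unfolding frechet_derivative_eq_sum_partial_deriv[OF test_function_differentiable[OF \<phi>]]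
        using u' by measurable
      have "(LINT x|lebesgue. (u x \<bullet> \<xi>) * frechet_derivative \<phi> (at x) \<xi>)
         = (LINT x|lebesgue. (u' x \<bullet> \<xi>) * frechet_derivative \<phi> (at x) \<xi>)"
      proof (rule integral_cong_AE)
        show m': "(\<lambda>x. (u' x \<bullet> \<xi>) * frechet_derivative \<phi> (at x) \<xi>) \<in> borel_measurable lebesgue"
          by (intro measurable_completion m)
        show ae2: "AE x in lebesgue. (u x \<bullet> \<xi>) * frechet_derivative \<phi> (at x) \<xi>
          = (u' x \<bullet> \<xi>) * frechet_derivative \<phi> (at x) \<xi>"
          using ae' by eventually_elim simp
        have "(\<lambda>x. frechet_derivative \<phi> (at x) \<xi>) \<in> borel_measurable lborel"
          unfolding frechet_derivative_eq_sum_partial_deriv[OF test_function_differentiable[OF \<phi>]]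
          by measurable
        then have "(\<lambda>x. frechet_derivative \<phi> (at x) \<xi>) \<in> borel_measurable lebesgue"
          by (intro measurable_completion)
        then show "(\<lambda>x. (u x \<bullet> \<xi>) * frechet_derivative \<phi> (at x) \<xi>) \<in> borel_measurable lebesgue"
          using \<open>integrable lebesgue u\<close> by (intro borel_measurable_times) auto
      qed
      also have "\<dots> = (LINT x|lborel. (u' x \<bullet> \<xi>) * frechet_derivative \<phi> (at x) \<xi>)"
        by (rule integral_completion[OF m])
      finally show "\<bar>LINT x|lborel. (u' x \<bullet> \<xi>) * frechet_derivative \<phi> (at x) \<xi>\<bar> \<le> C * (norm \<xi>)\<^sup>2 * M"
        using C[OF \<phi> M, of \<xi>] by simp
    qed
    then show ?thesis by (simp add: l1_def inner_diff_left)
  qed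
  then show ?thesis by (rule L1_modulus_of_continuity[OF int _ \<sigma>]) (rule that)
qed

subsection \<open>Dyadic cubes and the John-Nirenberg inequality\<close>

text \<open>For \<open>L > 0\<close> this is the half-open grid cube of side L / 2^k containing x.
  Naming a cube by any of its points makes the cubes of one generation the classes of an equivalence
  relation, so disjointness and nesting become statements about floors.\<close>

definition dyad :: "real \<Rightarrow> nat \<Rightarrow> real^'n::finite \<Rightarrow> (real^'n) set"
  where "dyad L k x = {y. \<forall>i. \<lfloor>2 ^ k * y $ i / L\<rfloor> = \<lfloor>2 ^ k * x $ i / L\<rfloor>}"

lemma dyad_self: "x \<in> dyad L k x"
  by (simp add: dyad_def)

lemma dyad_eq: "y \<in> dyad L k x \<Longrightarrow> dyad L k y = dyad L k x"
  by (simp add: dyad_def)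

lemma dyad_Suc_subset: "dyad L (Suc k) x \<subseteq> dyad L k x"
proof
  fix y assume y: "y \<in> dyad L (Suc k) x"
  have *: "\<lfloor>2 ^ k * z / L\<rfloor> = \<lfloor>2 ^ Suc k * z / L\<rfloor> div 2" for z :: real
    using floor_divide_real_eq_div[of 2 "2 ^ Suc k * z / L"] by simp
  show "y \<in> dyad L k x" using y unfolding dyad_def mem_Collect_eq * by simp
qed

lemma dyad_antimono: "k \<le> l \<Longrightarrow> dyad L l x \<subseteq> dyad L k x"
proof (induction l rule: dec_induct)
  case (step l)
  then show ?case using dyad_Suc_subset by blast
qed simp

lemma dyad_eq_le: "y \<in> dyad L k x \<Longrightarrow> l \<le> k \<Longrightarrow> dyad L l y = dyad L l x"
  using dyad_antimono[of l k L x] dyad_eq[of y L l x] by auto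

lemma dyad_borel [measurable]: "dyad L k x \<in> sets borel"
proof -
  have "Measurable.pred borel (\<lambda>y. \<forall>i. \<lfloor>2 ^ k * y $ i / L\<rfloor> = \<lfloor>2 ^ k * x $ i / L\<rfloor>)"
    by measurable
  then show ?thesis unfolding dyad_def by (simp add: pred_def)
qed

lemma countable_dyads: "countable {dyad L k x | k x. R k x}"
proof -
  have "{dyad L k x | k x. R k x} \<subseteq>
      (\<lambda>(k, z :: 'a \<Rightarrow> int). {y. \<forall>i. \<lfloor>2 ^ k * y $ i / L\<rfloor> = z i}) ` UNIV"
  proof
    fix Q assume "Q \<in> {dyad L k x | k x. R k x}"
    then obtain k x where "Q = dyad L k x" by blast
    then show "Q \<in> (\<lambda>(k, z :: 'a \<Rightarrow> int). {y. \<forall>i. \<lfloor>2 ^ k * y $ i / L\<rfloor> = z i}) ` UNIV"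
      by (intro image_eqI[of _ _ "(k, \<lambda>i. \<lfloor>2 ^ k * x $ i / L\<rfloor>)"]) (auto simp: dyad_def)
  qed
  then show ?thesis by (rule countable_subset) simp
qed

lemma
  fixes a b :: "real^'n::finite"
  assumes s: "\<And>i. b $ i - a $ i = s" "0 \<le> s"
  shows emeasure_cbox_cube: "emeasure lborel (cbox a b) = ennreal (s ^ CARD('n))"
    and emeasure_box_cube: "emeasure lborel (box a b) = ennreal (s ^ CARD('n))"
proof -
  have i: "(b - a) \<bullet> e = s" if "e \<in> Basis" for e
    using that s(1) by (auto simp: Basis_vec_def inner_axis)
  then have le: "\<And>e. e \<in> Basis \<Longrightarrow> a \<bullet> e \<le> b \<bullet> e" using s(2) by (metis inner_diff_left diff_ge_0_iff_ge)
  have "(\<Prod>e\<in>Basis. (b - a) \<bullet> e) = s ^ CARD('n)" using i by simp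
  then show "emeasure lborel (cbox a b) = ennreal (s ^ CARD('n))"
    "emeasure lborel (box a b) = ennreal (s ^ CARD('n))"
    using le by (simp_all add: emeasure_lborel_cbox emeasure_lborel_box)
qed

lemma emeasure_cube:
  fixes z :: "real^'n::finite"
  shows "0 \<le> r \<Longrightarrow> emeasure lborel (cube z r) = ennreal ((2 * r) ^ CARD('n))"
  unfolding cube_def by (rule emeasure_cbox_cube) auto

lemma
  fixes x :: "real^'n::finite"
  assumes L: "0 < L"
  shows dyad_subset_cube: "\<exists>z. dyad L k x \<subseteq> cube z (L / 2 ^ k / 2)"
    and emeasure_dyad: "emeasure lborel (dyad L k x) = ennreal ((L / 2 ^ k) ^ CARD('n))"
proof -
  let ?s = "L / 2 ^ k"
  define a :: "real^'n" where "a = (\<chi> i. of_int \<lfloor>2 ^ k * x $ i / L\<rfloor> * ?s)"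
  define b :: "real^'n" where "b = (\<chi> i. a $ i + ?s)"
  have s: "0 < ?s" using L by simp
  have fl: "\<lfloor>2 ^ k * t / L\<rfloor> = m \<longleftrightarrow> of_int m * ?s \<le> t \<and> t < of_int m * ?s + ?s" for t and m :: int
    using L by (auto simp: floor_eq_iff field_simps)
  have D: "dyad L k x = {y. \<forall>i. a $ i \<le> y $ i \<and> y $ i < b $ i}"
    unfolding dyad_def fl by (simp add: a_def b_def)
  have 1: "box a b \<subseteq> dyad L k x" unfolding D by (auto simp: mem_box_cart less_imp_le)
  have 2: "dyad L k x \<subseteq> cbox a b" unfolding D by (auto simp: mem_box_cart less_imp_le)
  have "emeasure lborel (dyad L k x) \<le> ennreal (?s ^ CARD('n))"
    using emeasure_mono[OF 2, of lborel] emeasure_cbox_cube[of b a ?s] s by (simp add: b_def)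
  moreover have "ennreal (?s ^ CARD('n)) \<le> emeasure lborel (dyad L k x)"
    using emeasure_mono[OF 1, of lborel] emeasure_box_cube[of b a ?s] s by (simp add: b_def)
  ultimately show "emeasure lborel (dyad L k x) = ennreal (?s ^ CARD('n))" by (rule antisym)
  have "cbox a b \<subseteq> cube (\<chi> i. a $ i + ?s / 2) (?s / 2)"
    by (auto simp: cube_def mem_box_cart b_def add.commute)
  then show "\<exists>z. dyad L k x \<subseteq> cube z (?s / 2)" using 2 by blast
qed

lemma dyad_subset_open:
  fixes x :: "real^'n::finite"
  assumes L: "0 < L" and U: "open U" "x \<in> U"
  shows "\<exists>k. dyad L k x \<subseteq> U"
proof -
  obtain e where e: "0 < e" "ball x e \<subseteq> U" using U unfolding open_contains_ball by blast
  let ?c = "real CARD('n)"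
  have "0 < e / (?c * L)" using e L by simp
  then obtain k where k: "(1/2) ^ k < e / (?c * L)" using real_arch_pow_inv[of _ "1/2"] by auto
  have "y \<in> ball x e" if y: "y \<in> dyad L k x" for y
  proof -
    have "\<bar>x $ i - y $ i\<bar> \<le> L / 2 ^ k" for i
    proof -
      have "\<lfloor>2 ^ k * y $ i / L\<rfloor> = \<lfloor>2 ^ k * x $ i / L\<rfloor>" using y by (simp add: dyad_def)
      then have "\<bar>2 ^ k * x $ i / L - 2 ^ k * y $ i / L\<bar> \<le> 1" by linarith
      then have "\<bar>(x $ i - y $ i) * (2 ^ k / L)\<bar> \<le> 1" by (simp add: algebra_simps diff_divide_distrib)
      then have "\<bar>x $ i - y $ i\<bar> * (2 ^ k / L) \<le> 1" using L by (simp only: abs_mult) simp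
      then have "\<bar>x $ i - y $ i\<bar> \<le> 1 / (2 ^ k / L)" using L by (intro mult_imp_le_div_pos) simp_all
      then show ?thesis by simp
    qed
    then have "norm (x - y) \<le> (\<Sum>i\<in>(UNIV::'n set). L / 2 ^ k)"
      by (intro order_trans[OF norm_le_l1_cart] sum_mono) simp
    also have "\<dots> = ?c * L * (1/2) ^ k" by (simp add: power_one_over field_simps)
    also have "\<dots> < e" using k L by (simp add: field_simps)
    finally show ?thesis by (simp add: dist_norm)
  qed
  then show ?thesis using e(2) by blast
qed

text \<open>The Calderon-Zygmund selection: the cubes with \<open>P\<close> none of whose ancestors
  satisfies \<open>P\<close> are countably many, pairwise disjoint and cover \<open>S\<close>, so
  the local inequality can be summed. The local inequality may use that all ancestors fail
  \<open>P\<close>, which is what brings in the parent cube later.\<close>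

lemma dyadic_stopping:
  fixes S T :: "(real^'n::finite) set"
  assumes S [measurable]: "S \<in> sets borel" and T [measurable]: "T \<in> sets borel"
    and cov: "\<And>x. x \<in> S \<Longrightarrow> \<exists>k. P (dyad L k x)"
    and le: "\<And>k x. P (dyad L k x) \<Longrightarrow> (\<And>l. l < k \<Longrightarrow> \<not> P (dyad L l x)) \<Longrightarrow>
      emeasure lborel (S \<inter> dyad L k x) \<le> \<theta> * emeasure lborel (T \<inter> dyad L k x)"
  shows "emeasure lborel S \<le> \<theta> * emeasure lborel T"
proof -
  \<comment> \<open>\<open>k\<close> is the first generation at which the cube around
    \<open>x\<close> has \<open>P\<close>. This is unchanged when \<open>x\<close> moves inside the
    cube, since all ancestors are shared.\<close>
  define R where "R k x \<longleftrightarrow> P (dyad L k x) \<and> (\<forall>l<k. \<not> P (dyad L l x))" for k and x :: "real^'n"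
  define \<Q> where "\<Q> = {dyad L k x | k x. R k x}"
  have cnt: "countable \<Q>" unfolding \<Q>_def by (rule countable_dyads)
  have meas: "Q \<in> sets borel" if "Q \<in> \<Q>" for Q using that unfolding \<Q>_def by auto
  have R_eq: "R k y" if "R k x" "y \<in> dyad L k x" for k x y
    using that dyad_eq_le[OF that(2)] unfolding R_def by (metis less_imp_le order_refl)
  have disj: "Q = Q'" if QQ: "Q \<in> \<Q>" "Q' \<in> \<Q>" and y: "y \<in> Q" "y \<in> Q'" for Q Q' y
  proof -
    obtain k x k' x' where Q: "Q = dyad L k x" "R k x" and Q': "Q' = dyad L k' x'" "R k' x'"
      using QQ unfolding \<Q>_def by blast
    have "R k y" "R k' y" using R_eq Q Q' y by auto
    then have "k = k'" unfolding R_def by (metis linorder_neqE_nat)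
    then show ?thesis using dyad_eq y Q Q' by metis
  qed
  have dj: "disjoint_family_on (\<lambda>Q. X \<inter> Q) \<Q>" for X :: "(real^'n) set"
    unfolding disjoint_family_on_def using disj by blast
  have cover: "S = (\<Union>Q\<in>\<Q>. S \<inter> Q)"
  proof -
    have "x \<in> (\<Union>Q\<in>\<Q>. Q)" if x: "x \<in> S" for x
    proof -
      define k where "k = (LEAST k. P (dyad L k x))"
      have "R k x"
        using LeastI_ex[OF cov[OF x]] not_less_Least unfolding R_def k_def by blast
      then show ?thesis using dyad_self[of x L k] unfolding \<Q>_def by blast
    qed
    then show ?thesis by blast
  qed
  have em: "emeasure lborel (\<Union>Q\<in>\<Q>. X \<inter> Q) = (\<integral>\<^sup>+Q. emeasure lborel (X \<inter> Q) \<partial>count_space \<Q>)"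
    if "X \<in> sets borel" for X
    using meas that by (intro emeasure_UN_countable cnt dj) auto
  have "emeasure lborel S = (\<integral>\<^sup>+Q. emeasure lborel (S \<inter> Q) \<partial>count_space \<Q>)"
    using em[OF S] cover by simp
  also have "\<dots> \<le> (\<integral>\<^sup>+Q. \<theta> * emeasure lborel (T \<inter> Q) \<partial>count_space \<Q>)"
  proof (rule nn_integral_mono)
    fix Q assume "Q \<in> space (count_space \<Q>)"
    then obtain k x where "Q = dyad L k x" "R k x" by (auto simp: \<Q>_def)
    then show "emeasure lborel (S \<inter> Q) \<le> \<theta> * emeasure lborel (T \<inter> Q)"
      using le[of k x] by (auto simp: R_def)
  qed
  also have "\<dots> = \<theta> * emeasure lborel (\<Union>Q\<in>\<Q>. T \<inter> Q)"
    unfolding em[OF T] by (rule nn_integral_cmult) simp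
  also have "\<dots> \<le> \<theta> * emeasure lborel T"
    by (intro mult_left_mono emeasure_mono) auto
  finally show ?thesis .
qed

section \<open>Density points and decay of superlevel sets\<close>

lemma half_ennreal: "ennreal (1/2) * ennreal x = ennreal (x / 2)"
  by (subst ennreal_mult'[symmetric]) simp_all

text \<open>A weak form of the Lebesgue density theorem: otherwise the cubes inside an open set slightly
  larger than \<open>S\<close> would each be at most half filled by \<open>S\<close>.\<close>

lemma dyadic_density:
  fixes T :: "(real^'n::finite) set"
  assumes L: "0 < L" and T [measurable]: "T \<in> sets borel" and fin: "emeasure lborel T < \<infinity>"
  defines "S \<equiv> {x \<in> T. \<forall>k. emeasure lborel (T \<inter> dyad L k x) \<le> ennreal (1/2) * emeasure lborel (dyad L k x)}"
  shows "S \<in> null_sets lborel"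
proof -
  let ?good = "\<lambda>Q. emeasure lborel (T \<inter> Q) \<le> ennreal (1/2) * emeasure lborel Q"
  let ?B = "{dyad L k x | k x. \<not> ?good (dyad L k x)}"
  \<comment> \<open>Measurability of \<open>S\<close>: what is removed from \<open>T\<close> is a
    union of countably many cubes.\<close>
  have "S = T - \<Union>?B"
  proof (intro set_eqI iffI)
    fix x assume x: "x \<in> S"
    then have "x \<in> T" and g: "\<And>k. ?good (dyad L k x)" by (auto simp: S_def)
    moreover have False if "x \<in> dyad L k y" "\<not> ?good (dyad L k y)" for k y
      using dyad_eq[OF that(1)] that(2) g[of k] by simp
    ultimately show "x \<in> T - \<Union>?B" by blast
  next
    fix x assume "x \<in> T - \<Union>?B"
    then show "x \<in> S" using dyad_self[of x L] unfolding S_def by blast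
  qed
  moreover have "\<Union>?B \<in> sets borel"
    by (rule sets.countable_Union[OF countable_dyads]) auto
  ultimately have S [measurable]: "S \<in> sets borel" by simp
  have fS: "emeasure lborel S < \<infinity>"
    by (rule le_less_trans[OF emeasure_mono fin]) (auto simp: S_def)
  have half: "emeasure lborel S \<le> ennreal (1/2) * emeasure lborel U" if U: "open U" "S \<subseteq> U" for U
  proof (rule dyadic_stopping[where P = "\<lambda>Q. Q \<subseteq> U" and L = L])
    show "\<exists>k. dyad L k x \<subseteq> U" if "x \<in> S" for x
      using dyad_subset_open[OF L U(1)] U(2) that by blast
    fix k x assume Q: "dyad L k x \<subseteq> U"
    show "emeasure lborel (S \<inter> dyad L k x) \<le> ennreal (1/2) * emeasure lborel (U \<inter> dyad L k x)"
    proof (cases "S \<inter> dyad L k x = {}")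
      case False
      then obtain y where y: "y \<in> S" "y \<in> dyad L k x" by blast
      have "emeasure lborel (S \<inter> dyad L k x) \<le> emeasure lborel (T \<inter> dyad L k x)"
        by (intro emeasure_mono) (auto simp: S_def)
      also have "\<dots> \<le> ennreal (1/2) * emeasure lborel (dyad L k x)"
      proof -
        have "emeasure lborel (T \<inter> dyad L k y) \<le> ennreal (1/2) * emeasure lborel (dyad L k y)"
          using y(1) unfolding S_def by blast
        then show ?thesis unfolding dyad_eq[OF y(2)] .
      qed
      finally show ?thesis using Q by (simp only: Int_absorb1)
    qed simp
  qed (use U in auto)
  have "emeasure lborel S = 0"
  proof (rule ccontr)
    assume "emeasure lborel S \<noteq> 0"
    then obtain m where m: "emeasure lborel S = ennreal m" "0 < m"
      using fS by (cases "emeasure lborel S") (auto simp: less_le)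
    \<comment> \<open>Outer regularity gives U of measure at most 3 m / 2, and \<open>half\<close>
      then forces m \<le> 3 m / 4.\<close>
    obtain U where U: "open U" "S \<subseteq> U" "emeasure lborel (U - S) < ennreal (m / 2)"
      using outer_regular_lborel[OF S, of "m / 2"] m by auto
    have "emeasure lborel U \<le> emeasure lborel S + emeasure lborel (U - S)"
      using emeasure_subadditive[of S lborel "U - S"] U by (simp add: Un_absorb1 Un_Diff_cancel)
    also have "\<dots> \<le> ennreal m + ennreal (m / 2)" using U(3) m by (intro add_mono) auto
    also have "\<dots> = ennreal (3 * m / 2)" using m by (simp flip: ennreal_plus)
    finally have "ennreal (1/2) * emeasure lborel U \<le> ennreal (1/2) * ennreal (3 * m / 2)"
      by (intro mult_left_mono) auto
    also have "\<dots> = ennreal (3 * m / 4)" unfolding half_ennreal by simp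
    finally have "ennreal m \<le> ennreal (3 * m / 4)"
      using half[OF U(1,2)] m by (metis order_trans)
    then show False using m by (simp add: ennreal_le_iff)
  qed
  then show ?thesis by (simp add: null_sets_def)
qed

text \<open>Stop at the maximal cubes more than half filled by \<open>{w > l}\<close>. In the parent of such a cube
  \<open>w \<le> l\<close> on at least half of the volume, so the constant \<open>c\<close> is at most \<open>l + 2 B\<close>.\<close>

lemma superlevel_decay:
  fixes w :: "real^'n::finite \<Rightarrow> real"
  assumes w [measurable]: "w \<in> borel_measurable borel" and B: "0 < B"
    and osc: "\<And>z r. 0 < r \<Longrightarrow> \<exists>c. (\<integral>\<^sup>+y\<in>cube z r. ennreal \<bar>w y - c\<bar> \<partial>lborel) \<le> ennreal (B * (2 * r) ^ CARD('n))"
    and L: "0 < L" and small: "emeasure lborel {x. l < w x} \<le> ennreal (L ^ CARD('n) / 2)"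
  shows "emeasure lborel {x. l + (2 * B + 2 ^ (CARD('n) + 2) * B) < w x}
    \<le> ennreal (1/2) * emeasure lborel {x. l < w x}"
proof -
  let ?n = "CARD('n)"
  let ?A = "2 ^ (?n + 2) * B"
  let ?T = "{x. l < w x}"
  let ?S = "{x. l + (2 * B + ?A) < w x}"
  let ?P = "\<lambda>Q. \<not> emeasure lborel (?T \<inter> Q) \<le> ennreal (1/2) * emeasure lborel Q"
  \<comment> \<open>\<open>N\<close> is the part of \<open>?T\<close> that the stopping cubes miss.
    By the density lemma it is null and can be discarded.\<close>
  define N where "N = {x \<in> ?T. \<forall>k. emeasure lborel (?T \<inter> dyad L k x) \<le> ennreal (1/2) * emeasure lborel (dyad L k x)}"
  have finT: "emeasure lborel ?T < \<infinity>" using small by (rule le_less_trans) simp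
  have N: "N \<in> null_sets lborel"
    unfolding N_def by (rule dyadic_density[OF L _ finT]) measurable
  then have [measurable]: "N \<in> sets borel" by auto
  have ST: "?S \<subseteq> ?T" using B by (auto intro: order.strict_trans1[rotated] simp: add_pos_pos)
  have "emeasure lborel ?S \<le> emeasure lborel ((?S - N) \<union> N)"
    by (intro emeasure_mono) auto
  also have "\<dots> \<le> emeasure lborel (?S - N) + emeasure lborel N"
    by (intro emeasure_subadditive) auto
  also have "\<dots> = emeasure lborel (?S - N)" using null_setsD1[OF N] by (simp only: add_0_right)
  also have "\<dots> \<le> ennreal (1/2) * emeasure lborel ?T"
  proof (rule dyadic_stopping[where P = ?P and L = L])
    show "\<exists>k. ?P (dyad L k x)" if "x \<in> ?S - N" for x
      using that ST unfolding N_def by blast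
    fix k x
    assume P: "?P (dyad L k x)" and min: "\<And>j. j < k \<Longrightarrow> \<not> ?P (dyad L j x)"
    \<comment> \<open>This is where \<open>small\<close> enters: a cube of side \<open>L\<close> is
      too large to be more than half filled by \<open>?T\<close>, so every stopping cube has a
      parent.\<close>
    have "k \<noteq> 0"
    proof
      assume "k = 0"
      have "emeasure lborel (?T \<inter> dyad L 0 x) \<le> emeasure lborel ?T"
        by (intro emeasure_mono) auto
      also have "\<dots> \<le> ennreal (1/2) * emeasure lborel (dyad L 0 x)"
        unfolding emeasure_dyad[OF L] half_ennreal using small by simp
      finally show False using P \<open>k = 0\<close> by blast
    qed
    then obtain m where k: "k = Suc m" using not0_implies_Suc[of k] by auto
    let ?Q = "dyad L k x" and ?Q' = "dyad L m x"
    define q where "q = (L / 2 ^ k) ^ ?n"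
    have q: "0 < q" using L by (simp add: q_def)
    have eQ: "emeasure lborel ?Q = ennreal q" by (simp add: emeasure_dyad[OF L] q_def)
    have q': "(L / 2 ^ m) ^ ?n = 2 ^ ?n * q"
      by (simp add: q_def k power_divide power_mult_distrib)
    have eQ': "emeasure lborel ?Q' = ennreal (2 ^ ?n * q)" by (simp add: emeasure_dyad[OF L] q')
    have notP: "emeasure lborel (?T \<inter> ?Q') \<le> ennreal (1/2) * emeasure lborel ?Q'"
      using min[of m] k by simp
    obtain z where z: "?Q' \<subseteq> cube z (L / 2 ^ m / 2)" using dyad_subset_cube[OF L, of m x] by auto
    obtain c where "(\<integral>\<^sup>+y\<in>cube z (L / 2 ^ m / 2). ennreal \<bar>w y - c\<bar> \<partial>lborel)
        \<le> ennreal (B * (2 * (L / 2 ^ m / 2)) ^ ?n)"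
      using osc[of "L / 2 ^ m / 2" z] L by auto
    then have c: "(\<integral>\<^sup>+y\<in>cube z (L / 2 ^ m / 2). ennreal \<bar>w y - c\<bar> \<partial>lborel) \<le> ennreal (B * (2 ^ ?n * q))"
      using q' by simp
    \<comment> \<open>Chebyshev's inequality in the parent cube, whose volume 2^n q is that of the
      grid-free cube carrying the oscillation bound.\<close>
    have markov: "ennreal \<tau> * emeasure lborel E \<le> ennreal (B * (2 ^ ?n * q))"
      if E: "E \<in> sets borel" "E \<subseteq> ?Q'" "\<And>y. y \<in> E \<Longrightarrow> \<tau> \<le> \<bar>w y - c\<bar>" for E \<tau>
    proof -
      have "ennreal \<tau> * emeasure lborel E = (\<integral>\<^sup>+y. ennreal \<tau> * indicator E y \<partial>lborel)"
        using E by (simp add: nn_integral_cmult_indicator)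
      also have "\<dots> \<le> (\<integral>\<^sup>+y\<in>cube z (L / 2 ^ m / 2). ennreal \<bar>w y - c\<bar> \<partial>lborel)"
        using E z by (intro nn_integral_mono) (auto simp: indicator_def intro!: ennreal_leI)
      finally show ?thesis using c by (rule order_trans)
    qed
    \<comment> \<open>If c exceeded l + 2 B, then |w - c| would be at least c - l > 2 B on half of
      the parent, and the oscillation there would exceed B times its volume.\<close>
    have cle: "c \<le> l + 2 * B"
    proof (rule ccontr)
      assume "\<not> c \<le> l + 2 * B"
      then have cl: "2 * B < c - l" by simp
      have "emeasure lborel (?Q' - ?T) \<ge> ennreal (2 ^ ?n * q / 2)"
      proof -
        have "ennreal (2 ^ ?n * q) \<le> emeasure lborel (?T \<inter> ?Q') + emeasure lborel (?Q' - ?T)"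
        proof -
          have "?Q' = (?T \<inter> ?Q') \<union> (?Q' - ?T)" by blast
          then show ?thesis
            using emeasure_subadditive[of "?T \<inter> ?Q'" lborel "?Q' - ?T"] eQ' by simp
        qed
        also have "\<dots> \<le> ennreal (2 ^ ?n * q / 2) + emeasure lborel (?Q' - ?T)"
          using notP unfolding eQ' half_ennreal by (intro add_right_mono)
        finally have *: "ennreal (2 ^ ?n * q / 2 + 2 ^ ?n * q / 2)
            \<le> ennreal (2 ^ ?n * q / 2) + emeasure lborel (?Q' - ?T)" by (simp only: field_sum_of_halves)
        have "emeasure lborel (?Q' - ?T) \<le> ennreal (2 ^ ?n * q)"
          using emeasure_mono[of "?Q' - ?T" ?Q' lborel] eQ' by simp
        then obtain e where e: "emeasure lborel (?Q' - ?T) = ennreal e" "0 \<le> e"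
          by (cases "emeasure lborel (?Q' - ?T)") (auto simp: top_unique)
        have gen: "a / 2 \<le> e" if "ennreal (a / 2 + a / 2) \<le> ennreal (a / 2) + ennreal e" "0 \<le> a" for a
          using that e(2) by (simp add: ennreal_le_iff flip: ennreal_plus)
        show ?thesis
          unfolding e(1) by (intro ennreal_leI gen[OF *[unfolded e(1)]]) (use q in simp)
      qed
      then have "ennreal (c - l) * ennreal (2 ^ ?n * q / 2) \<le> ennreal (c - l) * emeasure lborel (?Q' - ?T)"
        by (intro mult_left_mono) auto
      also have "\<dots> \<le> ennreal (B * (2 ^ ?n * q))"
        by (rule markov) auto
      finally have "(c - l) * (2 ^ ?n * q / 2) \<le> B * (2 ^ ?n * q)"
        using cl B q by (simp add: ennreal_le_iff flip: ennreal_mult)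
      then have "((c - l) / 2) * (2 ^ ?n * q) \<le> B * (2 ^ ?n * q)" by simp
      then have "(c - l) / 2 \<le> B" using q by (subst (asm) mult_le_cancel_right) (auto simp: not_less)
      then show False using cl by simp
    qed
    \<comment> \<open>On this set w - c > 2^(n+2) B, so its measure is at most B 2^n q / (2^(n+2) B)
      = q / 4. The stopping rule gives more than q / 2 for \<open>?T\<close>, whence the ratio 1/2;
      the choice of \<open>?A\<close> is made for this.\<close>
    have "ennreal ?A * emeasure lborel ((?S - N) \<inter> ?Q) \<le> ennreal (B * (2 ^ ?n * q))"
    proof (rule markov)
      show "(?S - N) \<inter> ?Q \<subseteq> ?Q'" using dyad_Suc_subset unfolding k by blast
      show "?A \<le> \<bar>w y - c\<bar>" if "y \<in> (?S - N) \<inter> ?Q" for y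
        using that cle by auto
    qed measurable
    then have *: "ennreal (2 ^ (?n + 2) * B) * emeasure lborel ((?S - N) \<inter> ?Q) \<le> ennreal (B * (2 ^ ?n * q))" .
    have "emeasure lborel ((?S - N) \<inter> ?Q) \<le> ennreal q"
      using emeasure_mono[of "(?S - N) \<inter> ?Q" ?Q lborel] eQ by simp
    then obtain e where e: "emeasure lborel ((?S - N) \<inter> ?Q) = ennreal e" "0 \<le> e"
      by (cases "emeasure lborel ((?S - N) \<inter> ?Q)") (auto simp: top_unique)
    have "2 ^ (?n + 2) * B * e \<le> B * (2 ^ ?n * q)"
      using * B q unfolding e(1) using e(2) by (simp add: ennreal_le_iff flip: ennreal_mult)
    then have "(2 ^ ?n * B) * (4 * e) \<le> (2 ^ ?n * B) * q" by (simp add: algebra_simps)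
    then have "4 * e \<le> q" using B by (subst (asm) mult_le_cancel_left_pos) auto
    then have "e \<le> 1/2 * (1/2 * q)" by simp
    then have "ennreal e \<le> ennreal (1/2) * ennreal (1/2 * q)"
      unfolding half_ennreal by (intro ennreal_leI) simp
    moreover have "ennreal (1/2 * q) \<le> emeasure lborel (?T \<inter> ?Q)"
      using P unfolding eQ half_ennreal by simp
    then have "ennreal (1/2) * ennreal (1/2 * q) \<le> ennreal (1/2) * emeasure lborel (?T \<inter> ?Q)"
      by (rule mult_left_mono) simp
    ultimately show "emeasure lborel ((?S - N) \<inter> ?Q) \<le> ennreal (1/2) * emeasure lborel (?T \<inter> ?Q)"
      unfolding e(1) by (rule order_trans)
  qed measurable
  finally show ?thesis .
qed

text \<open>Summation over layers that need not be disjoint: \<open>f\<close> is dominated by the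
  sum of c_k times the indicator of A_k as soon as each point has one suitable k. Nested superlevel
  sets and nested cubes can thus serve as layers directly.\<close>

lemma nn_integral_finite_if_covered:
  fixes c m :: "nat \<Rightarrow> real"
  assumes A [measurable]: "\<And>k. A k \<in> sets M" and c: "\<And>k. 0 \<le> c k" and m: "\<And>k. 0 \<le> m k"
    and Am: "\<And>k. emeasure M (A k) \<le> ennreal (m k)" and sum: "summable (\<lambda>k. c k * m k)"
    and cov: "\<And>x. x \<in> X \<Longrightarrow> \<exists>k. x \<in> A k \<and> f x \<le> c k"
  shows "(\<integral>\<^sup>+x\<in>X. ennreal (f x) \<partial>M) < \<infinity>"
proof -
  have "(\<integral>\<^sup>+x\<in>X. ennreal (f x) \<partial>M) \<le> (\<integral>\<^sup>+x. (\<Sum>k. ennreal (c k) * indicator (A k) x) \<partial>M)"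
  proof (rule nn_integral_mono)
    fix x
    show "ennreal (f x) * indicator X x \<le> (\<Sum>k. ennreal (c k) * indicator (A k) x)"
    proof (cases "x \<in> X")
      case True
      then obtain k where k: "x \<in> A k" "f x \<le> c k" using cov by blast
      then have "ennreal (f x) * indicator X x \<le> (\<Sum>k\<in>{k}. ennreal (c k) * indicator (A k) x)"
        using True by (simp add: ennreal_leI)
      also have "\<dots> \<le> (\<Sum>k. ennreal (c k) * indicator (A k) x)"
        by (rule sum_le_suminf) auto
      finally show ?thesis .
    qed simp
  qed
  also have "\<dots> = (\<Sum>k. \<integral>\<^sup>+x. ennreal (c k) * indicator (A k) x \<partial>M)"
    by (rule nn_integral_suminf) measurable
  also have "\<dots> = (\<Sum>k. ennreal (c k) * emeasure M (A k))"
    by (simp add: nn_integral_cmult_indicator)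
  also have "\<dots> \<le> (\<Sum>k. ennreal (c k * m k))"
  proof (intro suminf_le summableI)
    fix k
    show "ennreal (c k) * emeasure M (A k) \<le> ennreal (c k * m k)"
      unfolding ennreal_mult[OF c m] by (intro mult_left_mono Am) simp
  qed
  also have "\<dots> < \<infinity>"
    unfolding infinity_ennreal_def less_top[symmetric]
    by (rule ennreal_suminf_neq_top[OF sum]) (intro mult_nonneg_nonneg c m)
  finally show ?thesis .
qed

text \<open>The tangent bound for ln at scale c = 4 q D shows that the power grows at most like exp
  (k/4). Since exp (1/4) < 2, a convergent geometric series dominates.\<close>

lemma summable_linear_powr_half:
  fixes a D q :: real
  assumes D: "0 < D" and a: "0 < a" and q: "0 < q"
  shows "summable (\<lambda>k. (a + real k * D) powr q * (1/2) ^ k)"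
proof (rule summable_comparison_test')
  define c where "c = 4 * q * D"
  have c: "0 < c" using D q by (simp add: c_def)
  define C where "C = c powr q * exp (a / (4 * D))"
  have "exp (1/4 :: real) \<le> 1 + 1/4 + (1/4)\<^sup>2" by (rule exp_bound) auto
  then have "exp (1/4 :: real) / 2 < 1" by (simp add: power2_eq_square)
  then show "summable (\<lambda>k. C * (exp (1/4) / 2) ^ k)"
    by (intro summable_mult summable_geometric) simp
  fix k :: nat
  let ?x = "a + real k * D"
  have x: "0 < ?x" using a D by (simp add: add_pos_nonneg)
  have "ln (?x / c) \<le> ?x / c - 1" by (rule ln_le_minus_one) (use x c in simp)
  then have "ln ?x \<le> ?x / c + ln c" using x c by (simp add: ln_div)
  then have "q * ln ?x \<le> q * (?x / c) + q * ln c"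
    using q by (metis mult_left_mono distrib_left less_imp_le)
  moreover have "q * (?x / c) = a / (4 * D) + real k * (1/4)"
    using D q by (simp add: c_def field_simps)
  ultimately have "?x powr q \<le> exp (q * ln c + a / (4 * D) + real k * (1/4))"
    using x by (simp add: powr_def)
  also have "\<dots> = C * exp (1/4) ^ k"
    using c by (simp only: exp_add exp_of_nat_mult C_def powr_def) simp
  finally have "?x powr q * (1/2) ^ k \<le> C * exp (1/4) ^ k * (1/2) ^ k"
    by (rule mult_right_mono) simp
  then show "norm (?x powr q * (1/2) ^ k) \<le> C * (exp (1/4) / 2) ^ k"
    by (simp add: power_divide)
qed

text \<open>Above height 1, raising the level by \<open>D\<close> halves the measure of the
  superlevel set, so any power is summable over the layers. Below height 1, w^q \<le> w and
  integrability of \<open>w\<close> takes over.\<close>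

lemma nn_integral_powr_finite_if_bounded_oscillation:
  fixes w :: "real^'n::finite \<Rightarrow> real"
  assumes w [measurable]: "w \<in> borel_measurable borel" and w0: "\<And>x. 0 \<le> w x"
    and fin: "(\<integral>\<^sup>+x. ennreal (w x) \<partial>lborel) < \<infinity>" and B: "0 < B"
    and osc: "\<And>z r. 0 < r \<Longrightarrow> \<exists>c. (\<integral>\<^sup>+y\<in>cube z r. ennreal \<bar>w y - c\<bar> \<partial>lborel) \<le> ennreal (B * (2 * r) ^ CARD('n))"
    and q: "1 \<le> q"
  shows "(\<integral>\<^sup>+x. ennreal (w x powr q) \<partial>lborel) < \<infinity>"
proof -
  define D where "D = 2 * B + 2 ^ (CARD('n) + 2) * B"
  have D: "0 < D" using B by (simp add: D_def add_pos_pos)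
  obtain W where W: "(\<integral>\<^sup>+x. ennreal (w x) \<partial>lborel) = ennreal W" "0 \<le> W"
    using fin by (cases "\<integral>\<^sup>+x. ennreal (w x) \<partial>lborel") auto
  \<comment> \<open>By Chebyshev \<open>{w > 1}\<close> has measure at most W, and L^n \<ge> L \<ge>
    2 W makes this at most half of a grid cube, as \<open>superlevel_decay\<close> demands at every
    level.\<close>
  define L where "L = max 1 (2 * W)"
  have L: "0 < L" "1 \<le> L" "2 * W \<le> L" by (auto simp: L_def)
  have "L ^ 1 \<le> L ^ CARD('n)" using L by (intro power_increasing) auto
  then have WL: "W \<le> L ^ CARD('n) / 2" using L by simp
  let ?S = "\<lambda>k. {x. 1 + real k * D < w x}"
  have S: "emeasure lborel (?S k) \<le> ennreal ((1/2) ^ k * W)" for k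
  proof (induction k)
    case 0
    have "emeasure lborel (?S 0) = (\<integral>\<^sup>+x. indicator (?S 0) x \<partial>lborel)" by simp
    also have "\<dots> \<le> (\<integral>\<^sup>+x. ennreal (w x) \<partial>lborel)"
      by (intro nn_integral_mono) (auto simp: indicator_def simp flip: ennreal_1 intro!: ennreal_leI)
    finally show ?case using W by simp
  next
    case (Suc k)
    have "(1/2) ^ k * W \<le> 1 * W" using W by (intro mult_right_mono power_le_one) auto
    then have "emeasure lborel (?S k) \<le> ennreal (L ^ CARD('n) / 2)"
      using WL by (intro order_trans[OF Suc] ennreal_leI) simp
    from superlevel_decay[OF w B osc L(1) this]
    have "emeasure lborel {x. 1 + real k * D + D < w x} \<le> ennreal (1/2) * emeasure lborel (?S k)"
      unfolding D_def .
    also have "\<dots> \<le> ennreal (1/2) * ennreal ((1/2) ^ k * W)"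
      using Suc by (rule mult_left_mono) simp
    finally show ?case unfolding half_ennreal by (simp add: algebra_simps)
  qed
  have "(\<integral>\<^sup>+x\<in>{x. 1 < w x}. ennreal (w x powr q) \<partial>lborel) < \<infinity>"
  proof (rule nn_integral_finite_if_covered[where A = ?S and m = "\<lambda>k. (1/2) ^ k * W"
        and c = "\<lambda>k. (1 + D + real k * D) powr q"])
    have "summable (\<lambda>k. (1 + D + real k * D) powr q * (1/2) ^ k * W)"
      using D q by (intro summable_mult2 summable_linear_powr_half) auto
    then show "summable (\<lambda>k. (1 + D + real k * D) powr q * ((1/2) ^ k * W))"
      by (simp add: mult.assoc)
    fix x assume "x \<in> {x. 1 < w x}"
    then have pos: "0 < (w x - 1) / D" using D by simp
    \<comment> \<open>The ceiling minus one, not the floor: k < (w - 1) / D \<le> k + 1 must be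
      strict on the left because the superlevel sets are strict.\<close>
    define k where "k = nat (\<lceil>(w x - 1) / D\<rceil> - 1)"
    have "1 \<le> \<lceil>(w x - 1) / D\<rceil>" using pos by linarith
    then have "real k < (w x - 1) / D" "(w x - 1) / D \<le> real k + 1"
      unfolding k_def by linarith+
    then have "1 + real k * D < w x" "w x \<le> 1 + D + real k * D"
      using D by (simp_all add: field_simps)
    then show "\<exists>k. x \<in> ?S k \<and> w x powr q \<le> (1 + D + real k * D) powr q"
      using q w0[of x] by (intro exI[of _ k]) (auto intro!: powr_mono2)
  qed (use S W in auto)
  then have "(\<integral>\<^sup>+x. ennreal (w x) \<partial>lborel) + (\<integral>\<^sup>+x\<in>{x. 1 < w x}. ennreal (w x powr q) \<partial>lborel) < \<infinity>"
    using fin by simp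
  moreover have "(\<integral>\<^sup>+x. ennreal (w x powr q) \<partial>lborel)
    \<le> (\<integral>\<^sup>+x. ennreal (w x) + ennreal (w x powr q) * indicator {x. 1 < w x} x \<partial>lborel)"
  proof (rule nn_integral_mono)
    fix x
    have "w x powr q \<le> w x" if "w x \<le> 1"
      using powr_mono'[of 1 q "w x"] that q w0[of x] by simp
    then show "ennreal (w x powr q) \<le> ennreal (w x) + ennreal (w x powr q) * indicator {x. 1 < w x} x"
      by (cases "1 < w x") (auto intro!: ennreal_leI)
  qed
  moreover have "\<dots> = (\<integral>\<^sup>+x. ennreal (w x) \<partial>lborel) + (\<integral>\<^sup>+x\<in>{x. 1 < w x}. ennreal (w x powr q) \<partial>lborel)"
    by (rule nn_integral_add) measurable
  ultimately show ?thesis by (simp only: le_less_trans)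
qed

section \<open>From the sharp maximal function to higher integrability\<close>

lemma ennreal_le_mult_if_divide_le:
  fixes a b c :: ennreal
  assumes "a / b \<le> c" "b \<noteq> 0" "b < top"
  shows "a \<le> c * b"
proof -
  have "a = a / b * b" using assms by (simp add: ennreal_divide_times)
  also have "\<dots> \<le> c * b" by (rule mult_right_mono[OF assms(1)]) simp
  finally show ?thesis .
qed

text \<open>The sharp maximal function is bounded only at almost every centre, so z itself may be
  exceptional. A cube has positive measure and contains a good centre x; the cube of twice the size
  around x contains the given one.\<close>

lemma BMO_bounded_oscillation:
  fixes u u' :: "real^'n::finite \<Rightarrow> real^'m::finite"
  assumes "u \<in> BMO" and ae: "AE x in lborel. u x = u' x"
  obtains B where "0 < B"
    "\<And>z r. 0 < r \<Longrightarrow> \<exists>m. (\<integral>\<^sup>+y\<in>cube z r. ennreal (norm (u' y - m)) \<partial>lborel) \<le> ennreal (B * (2 * r) ^ CARD('n))"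
proof -
  have "sharp_maximal u \<in> L_infinity" using assms(1) unfolding BMO_def by blast
  then obtain C where "AE x in lebesgue. sharp_maximal u x \<le> ennreal C"
    unfolding L_infinity_def by blast
  then have C: "AE x in lborel. sharp_maximal u x \<le> ennreal C" by (simp add: AE_completion_iff)
  \<comment> \<open>2^n is the volume ratio between the doubled cube and the original; the maximum
    with 1 makes \<open>B\<close> positive.\<close>
  define B where "B = max C 1 * 2 ^ CARD('n)"
  show ?thesis
  proof (rule that[of B])
    show "0 < B" by (simp add: B_def)
    fix z :: "real^'n" and r :: real assume r: "0 < r"
    have "\<exists>x\<in>cube z r. sharp_maximal u x \<le> ennreal C"
    proof (rule ccontr)
      assume "\<not> ?thesis"
      then have "AE x in lborel. x \<notin> cube z r" using C by (auto elim!: eventually_mono)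
      then have "emeasure lborel (cube z r) = 0"
        by (subst (asm) AE_iff_measurable[where N = "cube z r"]) (auto simp: cube_def)
      then show False using r by (simp add: emeasure_cube)
    qed
    then obtain x where x: "x \<in> cube z r" "sharp_maximal u x \<le> ennreal C" by blast
    let ?Q = "cube x (2 * r)"
    let ?m = "mean ?Q u"
    have sub: "cube z r \<subseteq> ?Q"
    proof
      fix y assume "y \<in> cube z r"
      then have y: "z $ i - r \<le> y $ i" "y $ i \<le> z $ i + r" for i
        by (auto simp: cube_def mem_box_cart)
      have "z $ i - r \<le> x $ i" "x $ i \<le> z $ i + r" for i
        using x(1) by (auto simp: cube_def mem_box_cart)
      note x' = this
      have "x $ i - 2 * r \<le> y $ i \<and> y $ i \<le> x $ i + 2 * r" for i
        using y[of i] x'[of i] by linarith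
      then show "y \<in> ?Q" by (auto simp: cube_def mem_box_cart)
    qed
    have eQ: "emeasure lebesgue ?Q = ennreal ((4 * r) ^ CARD('n))"
      using emeasure_cube[of "2 * r" x] r by (simp add: cube_def)
    let ?I = "\<integral>\<^sup>+y\<in>?Q. ennreal (norm (u y - ?m)) \<partial>lebesgue"
    have "?I / emeasure lebesgue ?Q \<le> sharp_maximal u x"
      unfolding sharp_maximal_def using r by (intro SUP_upper) auto
    then have le: "?I / emeasure lebesgue ?Q \<le> ennreal C" using x(2) by (rule order_trans)
    have "?I \<le> ennreal C * ennreal ((4 * r) ^ CARD('n))"
      by (rule ennreal_le_mult_if_divide_le[OF le[unfolded eQ]]) (use r in simp_all)
    also have "\<dots> \<le> ennreal (B * (2 * r) ^ CARD('n))"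
    proof -
      have "(4 * r) ^ CARD('n) = 2 ^ CARD('n) * (2 * r) ^ CARD('n)"
        using power_mult_distrib[of 2 "2 * r" "CARD('n)"] by (simp only: mult.assoc[symmetric]) simp
      moreover have "C * (2 ^ CARD('n) * (2 * r) ^ CARD('n)) \<le> max C 1 * (2 ^ CARD('n) * (2 * r) ^ CARD('n))"
        using r by (intro mult_right_mono) auto
      ultimately have "C * (4 * r) ^ CARD('n) \<le> B * (2 * r) ^ CARD('n)"
        by (simp only: B_def mult.assoc)
      then have "ennreal (C * (4 * r) ^ CARD('n)) \<le> ennreal (B * (2 * r) ^ CARD('n))" by (rule ennreal_leI)
      then show ?thesis using r by (subst ennreal_mult''[symmetric]) auto
    qed
    finally have I: "?I \<le> ennreal (B * (2 * r) ^ CARD('n))" .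
    have "(\<integral>\<^sup>+y\<in>cube z r. ennreal (norm (u' y - ?m)) \<partial>lborel)
      = (\<integral>\<^sup>+y\<in>cube z r. ennreal (norm (u y - ?m)) \<partial>lborel)"
      using ae by (intro nn_integral_cong_AE) (auto elim!: eventually_mono)
    also have "\<dots> \<le> (\<integral>\<^sup>+y\<in>?Q. ennreal (norm (u y - ?m)) \<partial>lborel)"
      using sub by (intro nn_integral_mono mult_left_mono) (auto simp: indicator_def)
    also have "\<dots> = ?I" by (simp only: nn_integral_completion)
    finally show "\<exists>m. (\<integral>\<^sup>+y\<in>cube z r. ennreal (norm (u' y - m)) \<partial>lborel) \<le> ennreal (B * (2 * r) ^ CARD('n))"
      using I by (intro exI[of _ ?m]) (rule order_trans)
  qed
qed

text \<open>The reverse triangle inequality transfers the oscillation bound to the scalar function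
  norm u', with norm m as the constant.\<close>

lemma L1_BMO_Lq:
  fixes u u' :: "real^'n::finite \<Rightarrow> real^'m::finite"
  assumes "u \<in> BMO" and ae: "AE x in lborel. u x = u' x" and u' [measurable]: "u' \<in> borel_measurable borel"
    and fin: "(\<integral>\<^sup>+x. ennreal (norm (u' x)) \<partial>lborel) < \<infinity>" and q: "1 \<le> q"
  shows "(\<integral>\<^sup>+x. ennreal (norm (u' x) powr q) \<partial>lborel) < \<infinity>"
proof -
  obtain B where B: "0 < B"
    and osc: "\<And>z r. 0 < r \<Longrightarrow> \<exists>m. (\<integral>\<^sup>+y\<in>cube z r. ennreal (norm (u' y - m)) \<partial>lborel) \<le> ennreal (B * (2 * r) ^ CARD('n))"
    by (rule BMO_bounded_oscillation[OF assms(1) ae]) blast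
  show ?thesis
  proof (rule nn_integral_powr_finite_if_bounded_oscillation[OF _ _ fin B _ q])
    fix z :: "real^'n" and r :: real assume "0 < r"
    then obtain m where m: "(\<integral>\<^sup>+y\<in>cube z r. ennreal (norm (u' y - m)) \<partial>lborel) \<le> ennreal (B * (2 * r) ^ CARD('n))"
      using osc by blast
    have "(\<integral>\<^sup>+y\<in>cube z r. ennreal \<bar>norm (u' y) - norm m\<bar> \<partial>lborel) \<le> (\<integral>\<^sup>+y\<in>cube z r. ennreal (norm (u' y - m)) \<partial>lborel)"
      by (intro nn_integral_mono mult_right_mono ennreal_leI norm_triangle_ineq3) simp
    then show "\<exists>c. (\<integral>\<^sup>+y\<in>cube z r. ennreal \<bar>norm (u' y) - c\<bar> \<partial>lborel) \<le> ennreal (B * (2 * r) ^ CARD('n))"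
      using m by (intro exI[of _ "norm m"]) (rule order_trans)
  qed auto
qed

section \<open>Integrability of the radial kernel\<close>

lemma dyadic_scale:
  fixes x :: real
  assumes "1 \<le> x"
  obtains k :: nat where "2 ^ k \<le> x" "x < 2 ^ (k + 1)"
proof -
  define k where "k = nat \<lfloor>log 2 x\<rfloor>"
  have "0 \<le> \<lfloor>log 2 x\<rfloor>" using assms by simp
  then have "\<lfloor>log 2 x\<rfloor> = int k" by (simp add: k_def)
  then have "2 powr (real k) \<le> x" "x < 2 powr (real k + 1)"
    using floor_log_eq_powr_iff[of x 2 "int k"] assms by auto
  then show ?thesis using that[of k] by (simp add: powr_add powr_realpow)
qed

lemma norm_le_imp_mem_cube:
  fixes h :: "real^'n::finite"
  assumes "norm h \<le> r"
  shows "h \<in> cube 0 r"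
proof -
  have "- r \<le> h $ i \<and> h $ i \<le> r" for i
    using component_le_norm_cart[of h i] assms by linarith
  then show ?thesis by (simp add: cube_def mem_box_cart)
qed

lemma cube_borel [measurable]: "cube x r \<in> sets borel"
  by (simp add: cube_def)

text \<open>Dyadic cubes take the place of polar coordinates. At scale 2^-k near the origin the
  contribution is of order 2^(- (\<gamma> - \<tau>) k), at scale 2^k far out of order 2^(- \<tau>
  k): hence \<tau> < \<gamma> and 0 < \<tau>.\<close>

lemma nn_integral_radial_finite:
  fixes \<tau> \<gamma> :: real
  assumes \<tau>: "0 < \<tau>" and \<gamma>: "\<tau> < \<gamma>" "\<gamma> \<le> 1"
  shows "(\<integral>\<^sup>+h. ennreal (min 1 (norm h powr \<gamma>) / norm h powr (real CARD('n) + \<tau>)) \<partial>(lborel :: (real^'n::finite) measure)) < \<infinity>"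
proof -
  let ?n = "real CARD('n)"
  let ?f = "\<lambda>h::real^'n. min 1 (norm h powr \<gamma>) / norm h powr (?n + \<tau>)"
  have n: "1 \<le> ?n" using one_le_card_finite by simp
  then have n': "0 \<le> ?n + \<tau> - \<gamma>" using \<tau> \<gamma> by linarith
  have geom: "summable (\<lambda>k. C * (2 powr (- a)) ^ k)" if "0 < a" for a C :: real
    using that powr_less_mono[of "- a" 0 2] by (intro summable_mult summable_geometric) simp
  have near: "(\<integral>\<^sup>+h\<in>{h. h \<noteq> 0 \<and> norm h \<le> 1}. ennreal (?f h) \<partial>lborel) < \<infinity>"
  proof (rule nn_integral_finite_if_covered[where A = "\<lambda>k. cube 0 (1 / 2 ^ k)"
        and m = "\<lambda>k. (2 * (1 / 2 ^ k)) ^ CARD('n)" and c = "\<lambda>k. (2 ^ (k + 1)) powr (?n + \<tau> - \<gamma>)"])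
    have eq: "(2 ^ (k + 1)) powr (?n + \<tau> - \<gamma>) * (2 * (1 / 2 ^ k)) ^ CARD('n)
      = 2 powr (?n + \<tau> - \<gamma> + ?n) * (2 powr (- (\<gamma> - \<tau>))) ^ k" for k
    proof -
      have "(2 ^ (k + 1)) = (2::real) powr (real k + 1)" by (simp add: powr_add powr_realpow)
      then have "(2 ^ (k + 1)) powr (?n + \<tau> - \<gamma>) = 2 powr ((real k + 1) * (?n + \<tau> - \<gamma>))"
        by (simp only: powr_powr)
      moreover have "(2 * (1 / 2 ^ k)) ^ CARD('n) = (2::real) powr ((1 - real k) * ?n)"
      proof -
        have "(2 * (1 / 2 ^ k)) = (2::real) powr (1 - real k)" by (simp add: powr_diff powr_realpow)
        then show ?thesis by (simp add: powr_powr flip: powr_realpow)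
      qed
      moreover have "(2 powr (- (\<gamma> - \<tau>))) ^ k = 2 powr (- (\<gamma> - \<tau>) * real k)"
        by (simp add: powr_powr flip: powr_realpow)
      ultimately show ?thesis by (simp add: algebra_simps flip: powr_add)
    qed
    show "summable (\<lambda>k. (2 ^ (k + 1)) powr (?n + \<tau> - \<gamma>) * (2 * (1 / 2 ^ k)) ^ CARD('n))"
      unfolding eq by (rule geom) (use \<gamma> in simp)
    show "emeasure lborel (cube (0::real^'n) (1 / 2 ^ k)) \<le> ennreal ((2 * (1 / 2 ^ k)) ^ CARD('n))" for k
      by (simp add: emeasure_cube)
    fix h :: "real^'n" assume h: "h \<in> {h. h \<noteq> 0 \<and> norm h \<le> 1}"
    then have "1 \<le> 1 / norm h" by simp
    then obtain k where k: "2 ^ k \<le> 1 / norm h" "1 / norm h < 2 ^ (k + 1)" by (rule dyadic_scale)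
    have "norm h \<le> 1 / 2 ^ k" using k(1) h by (simp add: field_simps)
    moreover have "?f h \<le> (2 ^ (k + 1)) powr (?n + \<tau> - \<gamma>)"
    proof -
      have "?f h \<le> norm h powr \<gamma> / norm h powr (?n + \<tau>)" by (intro divide_right_mono) auto
      also have "\<dots> = (1 / norm h) powr (?n + \<tau> - \<gamma>)"
        using h by (simp add: powr_divide powr_diff)
      also have "\<dots> \<le> (2 ^ (k + 1)) powr (?n + \<tau> - \<gamma>)"
        using k(2) n' by (intro powr_mono2) auto
      finally show ?thesis .
    qed
    ultimately show "\<exists>k. h \<in> cube 0 (1 / 2 ^ k) \<and> ?f h \<le> (2 ^ (k + 1)) powr (?n + \<tau> - \<gamma>)"
      using norm_le_imp_mem_cube by blast
  qed auto
  have far: "(\<integral>\<^sup>+h\<in>{h. 1 < norm h}. ennreal (?f h) \<partial>lborel) < \<infinity>"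
  proof (rule nn_integral_finite_if_covered[where A = "\<lambda>k. cube 0 (2 ^ (k + 1))"
        and m = "\<lambda>k. (2 * 2 ^ (k + 1)) ^ CARD('n)" and c = "\<lambda>k. (2 ^ k) powr (- (?n + \<tau>))"])
    have eq: "(2 ^ k) powr (- (?n + \<tau>)) * (2 * 2 ^ (k + 1)) ^ CARD('n)
      = 2 powr (2 * ?n) * (2 powr (- \<tau>)) ^ k" for k
    proof -
      have "(2 ^ k) powr (- (?n + \<tau>)) = 2 powr (real k * (- (?n + \<tau>)))"
        by (simp add: powr_powr flip: powr_realpow)
      moreover have "(2 * 2 ^ (k + 1)) ^ CARD('n) = (2::real) powr ((real k + 2) * ?n)"
      proof -
        have "(2 * 2 ^ (k + 1)) = (2::real) powr (real k + 2)" by (simp add: powr_add powr_realpow)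
        then show ?thesis by (simp add: powr_powr flip: powr_realpow)
      qed
      moreover have "(2 powr (- \<tau>)) ^ k = 2 powr (- \<tau> * real k)"
        by (simp add: powr_powr flip: powr_realpow)
      ultimately show ?thesis by (simp add: algebra_simps flip: powr_add)
    qed
    show "summable (\<lambda>k. (2 ^ k) powr (- (?n + \<tau>)) * (2 * 2 ^ (k + 1)) ^ CARD('n))"
      unfolding eq by (rule geom[OF \<tau>])
    show "emeasure lborel (cube (0::real^'n) (2 ^ (k + 1))) \<le> ennreal ((2 * 2 ^ (k + 1)) ^ CARD('n))" for k
      by (simp add: emeasure_cube)
    fix h :: "real^'n" assume h: "h \<in> {h. 1 < norm h}"
    then have "1 \<le> norm h" by simp
    then obtain k where k: "2 ^ k \<le> norm h" "norm h < 2 ^ (k + 1)" by (rule dyadic_scale)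
    have "?f h \<le> (2 ^ k) powr (- (?n + \<tau>))"
    proof -
      have "?f h \<le> 1 / norm h powr (?n + \<tau>)" by (intro divide_right_mono) auto
      also have "\<dots> = norm h powr (- (?n + \<tau>))" by (simp only: powr_minus_divide)
      also have "\<dots> \<le> (2 ^ k) powr (- (?n + \<tau>))"
        using k(1) \<tau> n by (intro powr_mono2') auto
      finally show ?thesis .
    qed
    then show "\<exists>k. h \<in> cube 0 (2 ^ (k + 1)) \<and> ?f h \<le> (2 ^ k) powr (- (?n + \<tau>))"
      using norm_le_imp_mem_cube[of h "2 ^ (k + 1)"] k(2) by (intro exI[of _ k]) simp
  qed auto
  have "(\<integral>\<^sup>+h. ennreal (?f h) \<partial>lborel)
    = (\<integral>\<^sup>+h. ennreal (?f h) * indicator {h. h \<noteq> 0 \<and> norm h \<le> 1} h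
          + ennreal (?f h) * indicator {h. 1 < norm h} h \<partial>lborel)"
    by (intro nn_integral_cong) (auto simp: indicator_def)
  also have "\<dots> = (\<integral>\<^sup>+h\<in>{h. h \<noteq> 0 \<and> norm h \<le> 1}. ennreal (?f h) \<partial>lborel)
      + (\<integral>\<^sup>+h\<in>{h. 1 < norm h}. ennreal (?f h) \<partial>lborel)"
    by (rule nn_integral_add) measurable
  finally show ?thesis using near far by (simp add: ennreal_add_less_top)
qed

subsection \<open>The Gagliardo seminorm\<close>

text \<open>Up to the threshold \<open>M\<close>, a^(p-1) \<le> M^(p-1); beyond it, a^(p-q) \<le>
  M^(p-q) because p \<le> q. The free threshold replaces Hoelder interpolation and can be tuned to
  the step h.\<close>

lemma powr_interpolation:
  fixes a M p q :: real
  assumes "0 \<le> a" "0 < M" "1 \<le> p" "p \<le> q"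
  shows "a powr p \<le> M powr (p - 1) * a + M powr (p - q) * a powr q"
proof (cases "a \<le> M")
  case True
  have "a powr p = a powr (p - 1) * a"
    using assms powr_add[of a "p - 1" 1] by simp
  also have "\<dots> \<le> M powr (p - 1) * a"
    using assms True by (intro mult_right_mono powr_mono2) auto
  finally show ?thesis by (simp add: add_increasing2)
next
  case False
  have "a powr p = a powr (p - q) * a powr q" by (simp flip: powr_add)
  also have "\<dots> \<le> M powr (p - q) * a powr q"
    using assms False by (intro mult_right_mono powr_mono2') auto
  finally show ?thesis using assms by (simp add: add_increasing)
qed

lemma powr_add_le:
  fixes a b q :: real
  assumes "0 \<le> a" "0 \<le> b" "0 \<le> q"
  shows "(a + b) powr q \<le> 2 powr q * (a powr q + b powr q)"
proof -
  have "(a + b) powr q \<le> (2 * max a b) powr q" using assms by (intro powr_mono2) auto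
  also have "\<dots> = 2 powr q * max a b powr q" using assms by (simp add: powr_mult)
  also have "\<dots> \<le> 2 powr q * (a powr q + b powr q)" by (intro mult_left_mono) (auto simp: max_def)
  finally show ?thesis .
qed

lemma difference_Lq_bound:
  fixes u :: "real^'n::finite \<Rightarrow> real^'m::finite"
  assumes u [measurable]: "u \<in> borel_measurable borel" and q: "0 \<le> q"
    and fin: "(\<integral>\<^sup>+x. ennreal (norm (u x) powr q) \<partial>lborel) < \<infinity>"
  obtains K where "0 \<le> K" "\<And>h. (\<integral>\<^sup>+x. ennreal (norm (u (x + h) - u x) powr q) \<partial>lborel) \<le> ennreal K"
proof -
  obtain I where I: "(\<integral>\<^sup>+x. ennreal (norm (u x) powr q) \<partial>lborel) = ennreal I" "0 \<le> I"
    using fin by (cases "\<integral>\<^sup>+x. ennreal (norm (u x) powr q) \<partial>lborel") auto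
  have "(\<integral>\<^sup>+x. ennreal (norm (u (x + h) - u x) powr q) \<partial>lborel) \<le> ennreal (2 powr q * (I + I))" for h
  proof -
    have "(\<integral>\<^sup>+x. ennreal (norm (u (x + h) - u x) powr q) \<partial>lborel)
      \<le> (\<integral>\<^sup>+x. ennreal (2 powr q) * (ennreal (norm (u (x + h)) powr q) + ennreal (norm (u x) powr q)) \<partial>lborel)"
    proof (rule nn_integral_mono)
      fix x
      have "norm (u (x + h) - u x) powr q \<le> (norm (u (x + h)) + norm (u x)) powr q"
        using q by (intro powr_mono2 norm_triangle_ineq4) auto
      also have "\<dots> \<le> 2 powr q * (norm (u (x + h)) powr q + norm (u x) powr q)"
        using q by (intro powr_add_le) auto
      finally have "ennreal (norm (u (x + h) - u x) powr q)
        \<le> ennreal (2 powr q * (norm (u (x + h)) powr q + norm (u x) powr q))" by (rule ennreal_leI)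
      then show "ennreal (norm (u (x + h) - u x) powr q)
        \<le> ennreal (2 powr q) * (ennreal (norm (u (x + h)) powr q) + ennreal (norm (u x) powr q))"
        by (simp add: ennreal_mult)
    qed
    also have "\<dots> = ennreal (2 powr q) * ((\<integral>\<^sup>+x. ennreal (norm (u (x + h)) powr q) \<partial>lborel)
        + (\<integral>\<^sup>+x. ennreal (norm (u x) powr q) \<partial>lborel))"
      by (simp add: nn_integral_cmult nn_integral_add)
    also have "(\<integral>\<^sup>+x. ennreal (norm (u (x + h)) powr q) \<partial>lborel) = ennreal I"
      using nn_integral_translate[of "\<lambda>x. ennreal (norm (u x) powr q)" h] I by simp
    also have "(\<integral>\<^sup>+x. ennreal (norm (u x) powr q) \<partial>lborel) = ennreal I" by (rule I(1))
    also have "ennreal (2 powr q) * (ennreal I + ennreal I) = ennreal (2 powr q * (I + I))"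
      by (simp only: ennreal_mult[OF powr_ge_zero add_nonneg_nonneg[OF I(2) I(2)]] ennreal_plus[OF I(2) I(2)])
    finally show ?thesis .
  qed
  then show ?thesis using that[of "2 powr q * (I + I)"] I by simp
qed

lemma difference_Lp_modulus:
  fixes u :: "real^'n::finite \<Rightarrow> real^'n"
  assumes u: "integrable lborel u"
    and Lq: "\<And>q. 1 \<le> q \<Longrightarrow> (\<integral>\<^sup>+x. ennreal (norm (u x) powr q) \<partial>lborel) < \<infinity>"
    and mod1: "\<And>\<sigma>. 0 < \<sigma> \<Longrightarrow> \<sigma> < 1 \<Longrightarrow> \<exists>K\<ge>0. \<forall>h. norm h \<le> 1 \<longrightarrow>
      (LINT x|lborel. norm (u (x + h) - u x)) \<le> K * norm h powr \<sigma>"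
    and p: "1 < p" and \<gamma>: "0 < \<gamma>" "\<gamma> < 1"
  obtains K where "0 \<le> K"
    "\<And>h. (\<integral>\<^sup>+x. ennreal (norm (u (x + h) - u x) powr p) \<partial>lborel) \<le> ennreal (K * min 1 (norm h powr \<gamma>))"
proof -
  have [measurable]: "u \<in> borel_measurable borel" using u by auto
  \<comment> \<open>With threshold M = |h|^(-\<delta>) the two terms scale with exponents \<sigma> -
    \<delta> (p - 1) and \<delta> (q - p). \<sigma> is the midpoint of \<gamma> and 1, and \<delta>
    and then \<open>q\<close> are solved for so that both exponents equal \<gamma>.\<close>
  define \<sigma> where "\<sigma> = (1 + \<gamma>) / 2"
  define \<delta> where "\<delta> = (1 - \<gamma>) / (2 * (p - 1))"
  define q where "q = p + \<gamma> / \<delta>"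
  have \<delta>: "0 < \<delta>" using p \<gamma> by (simp add: \<delta>_def)
  have \<sigma>: "0 < \<sigma>" "\<sigma> < 1" using \<gamma> by (auto simp: \<sigma>_def)
  have "0 \<le> \<gamma> / \<delta>" using \<gamma> \<delta> by simp
  then have q: "p \<le> q" "1 \<le> q" using p unfolding q_def by linarith+
  have e1: "- \<delta> * (p - 1) + \<sigma> = \<gamma>" using p by (simp add: \<delta>_def \<sigma>_def field_simps)
  have e2: "- \<delta> * (p - q) = \<gamma>" using \<delta> by (simp add: q_def)
  obtain K1 where K1: "0 \<le> K1"
    "\<And>h. norm h \<le> 1 \<Longrightarrow> (LINT x|lborel. norm (u (x + h) - u x)) \<le> K1 * norm h powr \<sigma>"
    using mod1[OF \<sigma>] by blast
  obtain Kq where Kq: "0 \<le> Kq" "\<And>h. (\<integral>\<^sup>+x. ennreal (norm (u (x + h) - u x) powr q) \<partial>lborel) \<le> ennreal Kq"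
    by (rule difference_Lq_bound[of u q]) (use q Lq in auto)
  obtain Kp where Kp: "0 \<le> Kp" "\<And>h. (\<integral>\<^sup>+x. ennreal (norm (u (x + h) - u x) powr p) \<partial>lborel) \<le> ennreal Kp"
    by (rule difference_Lq_bound[of u p]) (use p Lq in auto)
  define K where "K = Kp + K1 + Kq"
  show ?thesis
  proof (rule that[of K])
    show "0 \<le> K" using K1 Kq Kp by (simp add: K_def)
    fix h :: "real^'n"
    let ?G = "\<integral>\<^sup>+x. ennreal (norm (u (x + h) - u x) powr p) \<partial>lborel"
    consider "h = 0" | "1 < norm h" | "h \<noteq> 0" "norm h \<le> 1" by linarith
    then show "?G \<le> ennreal (K * min 1 (norm h powr \<gamma>))"
    proof cases
      case 1
      then show ?thesis by simp
    next
      case 2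
      then have "1 \<le> norm h powr \<gamma>" using \<gamma> by (intro ge_one_powr_ge_zero) auto
      then show ?thesis using Kp(1) K1(1) Kq(1)
        by (intro order_trans[OF Kp(2)] ennreal_leI) (simp add: K_def min_absorb1)
    next
      case 3
      define M where "M = norm h powr (- \<delta>)"
      have M: "0 < M" using 3 by (simp add: M_def)
      have "integrable lborel (\<lambda>x. u (x + h))" using u by (simp add: integrable_translate_iff)
      then have "(\<integral>\<^sup>+x. ennreal (norm (u (x + h) - u x)) \<partial>lborel)
          = ennreal (LINT x|lborel. norm (u (x + h) - u x))"
        using u by (intro nn_integral_eq_integral) auto
      then have I1: "(\<integral>\<^sup>+x. ennreal (norm (u (x + h) - u x)) \<partial>lborel) \<le> ennreal (K1 * norm h powr \<sigma>)"
        using K1(2)[OF 3(2)] by (simp add: ennreal_leI)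
      have "?G \<le> (\<integral>\<^sup>+x. ennreal (M powr (p - 1)) * ennreal (norm (u (x + h) - u x))
          + ennreal (M powr (p - q)) * ennreal (norm (u (x + h) - u x) powr q) \<partial>lborel)"
      proof (rule nn_integral_mono)
        fix x
        have "ennreal (norm (u (x + h) - u x) powr p) \<le> ennreal (M powr (p - 1) * norm (u (x + h) - u x)
           + M powr (p - q) * norm (u (x + h) - u x) powr q)"
          using M p q by (intro ennreal_leI powr_interpolation) auto
        then show "ennreal (norm (u (x + h) - u x) powr p) \<le> ennreal (M powr (p - 1)) * ennreal (norm (u (x + h) - u x))
           + ennreal (M powr (p - q)) * ennreal (norm (u (x + h) - u x) powr q)"
          by (simp add: ennreal_mult)
      qed
      also have "\<dots> = ennreal (M powr (p - 1)) * (\<integral>\<^sup>+x. ennreal (norm (u (x + h) - u x)) \<partial>lborel)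
          + ennreal (M powr (p - q)) * (\<integral>\<^sup>+x. ennreal (norm (u (x + h) - u x) powr q) \<partial>lborel)"
        by (simp add: nn_integral_add nn_integral_cmult)
      also have "\<dots> \<le> ennreal (M powr (p - 1)) * ennreal (K1 * norm h powr \<sigma>) + ennreal (M powr (p - q)) * ennreal Kq"
        by (intro add_mono mult_left_mono I1 Kq(2)) auto
      also have "\<dots> = ennreal (M powr (p - 1) * (K1 * norm h powr \<sigma>) + M powr (p - q) * Kq)"
        using K1 Kq by (simp add: ennreal_mult)
      also have "M powr (p - 1) * (K1 * norm h powr \<sigma>) = K1 * norm h powr \<gamma>"
      proof -
        have "M powr (p - 1) * norm h powr \<sigma> = norm h powr (- \<delta> * (p - 1) + \<sigma>)"
          by (simp only: M_def powr_powr powr_add)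
        then show ?thesis unfolding e1 by simp
      qed
      also have "M powr (p - q) * Kq = Kq * norm h powr \<gamma>"
        by (simp only: M_def powr_powr e2 mult.commute)
      also have "ennreal (K1 * norm h powr \<gamma> + Kq * norm h powr \<gamma>) \<le> ennreal (K * min 1 (norm h powr \<gamma>))"
      proof (rule ennreal_leI)
        have "norm h powr \<gamma> \<le> 1" using 3 \<gamma> by (intro powr_le1) auto
        then have "min 1 (norm h powr \<gamma>) = norm h powr \<gamma>" by simp
        moreover have "0 \<le> Kp * norm h powr \<gamma>" using Kp(1) by simp
        ultimately show "K1 * norm h powr \<gamma> + Kq * norm h powr \<gamma> \<le> K * min 1 (norm h powr \<gamma>)"
          by (simp add: K_def distrib_right)
      qed
      finally show ?thesis .
    qed
  qed
qed

text \<open>Writing y = x + h and integrating in x first turns the double integral into that of the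
  modulus of continuity against the kernel |h|^-(n + \<tau>).\<close>

lemma gagliardo_seminorm_finite:
  fixes u :: "real^'n::finite \<Rightarrow> real^'m::finite"
  assumes u [measurable]: "u \<in> borel_measurable borel" and K: "0 \<le> K"
    and mod: "\<And>h. (\<integral>\<^sup>+x. ennreal (norm (u (x + h) - u x) powr p) \<partial>lborel) \<le> ennreal (K * min 1 (norm h powr \<gamma>))"
    and \<tau>: "0 < \<tau>" "\<tau> < \<gamma>" "\<gamma> \<le> 1"
  shows "(\<integral>\<^sup>+x. (\<integral>\<^sup>+y. ennreal (norm (u x - u y) powr p / norm (x - y) powr (real CARD('n) + \<tau>))
      \<partial>lborel) \<partial>lborel) < \<infinity>"
proof -
  let ?e = "real CARD('n) + \<tau>"
  let ?f = "\<lambda>h x. ennreal (norm (u (x + h) - u x) powr p / norm h powr ?e)"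
  have "(\<integral>\<^sup>+y. ennreal (norm (u x - u y) powr p / norm (x - y) powr ?e) \<partial>lborel)
      = (\<integral>\<^sup>+h. ?f h x \<partial>lborel)" for x
  proof -
    have "(\<integral>\<^sup>+y. ennreal (norm (u x - u y) powr p / norm (x - y) powr ?e) \<partial>lborel)
      = (\<integral>\<^sup>+h. ennreal (norm (u x - u (h + x)) powr p / norm (x - (h + x)) powr ?e) \<partial>lborel)"
      by (rule nn_integral_translate[symmetric]) measurable
    also have "\<dots> = (\<integral>\<^sup>+h. ?f h x \<partial>lborel)"
      by (simp add: norm_minus_commute add.commute)
    finally show ?thesis .
  qed
  then have "(\<integral>\<^sup>+x. (\<integral>\<^sup>+y. ennreal (norm (u x - u y) powr p / norm (x - y) powr ?e) \<partial>lborel) \<partial>lborel)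
    = (\<integral>\<^sup>+x. (\<integral>\<^sup>+h. ?f h x \<partial>lborel) \<partial>lborel)" by simp
  also have "\<dots> = (\<integral>\<^sup>+h. (\<integral>\<^sup>+x. ?f h x \<partial>lborel) \<partial>lborel)"
    by (rule lborel_pair.Fubini') measurable
  also have "\<dots> \<le> (\<integral>\<^sup>+h. ennreal K * ennreal (min 1 (norm h powr \<gamma>) / norm h powr ?e) \<partial>(lborel :: (real^'n) measure))"
  proof (rule nn_integral_mono)
    fix h :: "real^'n"
    have "(\<integral>\<^sup>+x. ?f h x \<partial>lborel)
      = (\<integral>\<^sup>+x. ennreal (norm (u (x + h) - u x) powr p) * ennreal (1 / norm h powr ?e) \<partial>lborel)"
      by (simp flip: ennreal_mult)
    also have "\<dots> = (\<integral>\<^sup>+x. ennreal (norm (u (x + h) - u x) powr p) \<partial>lborel) * ennreal (1 / norm h powr ?e)"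
      by (rule nn_integral_multc) measurable
    also have "\<dots> \<le> ennreal (K * min 1 (norm h powr \<gamma>)) * ennreal (1 / norm h powr ?e)"
      by (intro mult_right_mono mod) simp
    also have "\<dots> = ennreal K * ennreal (min 1 (norm h powr \<gamma>) / norm h powr ?e)"
      using K by (simp flip: ennreal_mult)
    finally show "(\<integral>\<^sup>+x. ?f h x \<partial>lborel) \<le> ennreal K * ennreal (min 1 (norm h powr \<gamma>) / norm h powr ?e)" .
  qed
  also have "\<dots> = ennreal K * (\<integral>\<^sup>+h. ennreal (min 1 (norm h powr \<gamma>) / norm h powr ?e) \<partial>(lborel :: (real^'n) measure))"
    by (rule nn_integral_cmult) measurable
  also have "\<dots> < \<infinity>"
    using nn_integral_radial_finite[where 'n = 'n, OF \<tau>] by (simp add: ennreal_mult_less_top)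
  finally show ?thesis .
qed

section \<open>Borel representatives and the conclusion\<close>

lemma lebesgue_measurable_ex_borel:
  fixes u :: "'a::euclidean_space \<Rightarrow> 'b::euclidean_space"
  assumes "u \<in> borel_measurable lebesgue"
  obtains u' where "u' \<in> borel_measurable borel" "AE x in lborel. u x = u' x"
proof -
  have "\<exists>g\<in>borel_measurable lborel. AE x in lborel. u x \<bullet> b = g x" for b
    using assms by (intro completion_ex_borel_measurable_real) simp
  then obtain g where g: "\<And>b. g b \<in> borel_measurable lborel" "\<And>b. AE x in lborel. u x \<bullet> b = g b x"
    by metis
  show ?thesis
  proof (rule that[of "\<lambda>x. \<Sum>b\<in>Basis. g b x *\<^sub>R b"])
    show "(\<lambda>x. \<Sum>b\<in>Basis. g b x *\<^sub>R b) \<in> borel_measurable borel"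
      using g(1) by (intro borel_measurable_sum borel_measurable_scaleR) auto
    have "AE x in lborel. \<forall>b\<in>Basis. u x \<bullet> b = g b x"
      using g(2) by (intro AE_finite_allI) auto
    then show "AE x in lborel. u x = (\<Sum>b\<in>Basis. g b x *\<^sub>R b)"
    proof eventually_elim
      case (elim x)
      have "u x = (\<Sum>b\<in>Basis. (u x \<bullet> b) *\<^sub>R b)" by (simp only: euclidean_representation)
      also have "\<dots> = (\<Sum>b\<in>Basis. g b x *\<^sub>R b)" using elim by (intro sum.cong) auto
      finally show ?case .
    qed
  qed
qed

theorem theorem3p1:
  fixes p \<epsilon> :: real and n :: real
  defines "n \<equiv> real CARD('n::finite)"
  assumes "CARD('n) \<ge> 2"
    and "1 < p"
    and "0 < \<epsilon>"
    and "\<epsilon> < min ((n - 1) * (1 - 1 / p) / (1 + p * n - p)) (1 / p)"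
  shows "(BD :: (real^'n \<Rightarrow> real^'n) set) \<inter> BMO \<subseteq> frac_sobolev (1 / p - \<epsilon>) p"
proof
  fix u :: "real^'n \<Rightarrow> real^'n" assume "u \<in> BD \<inter> BMO"
  then have BD: "u \<in> BD" and BMO: "u \<in> BMO" by auto
  have u: "integrable lebesgue u" using BD unfolding BD_def by blast
  then have meas: "u \<in> borel_measurable lebesgue" by auto
  obtain u' where u' [measurable]: "u' \<in> borel_measurable borel" and ae: "AE x in lborel. u x = u' x"
    using lebesgue_measurable_ex_borel[OF meas] by blast
  have int: "integrable lborel u'"
  proof -
    have m: "u' \<in> borel_measurable lebesgue" by (intro measurable_completion) simp
    have "AE x in lebesgue. u x = u' x" using ae by (simp add: AE_completion_iff)
    then have "integrable lebesgue u'" using integrable_cong_AE[OF meas m] u by blast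
    then show ?thesis using u' by (simp add: integrable_completion)
  qed
  then have fin: "(\<integral>\<^sup>+x. ennreal (norm (u' x)) \<partial>lborel) < \<infinity>"
    by (simp add: integrable_iff_bounded)
  have Lq: "(\<integral>\<^sup>+x. ennreal (norm (u' x) powr q) \<partial>lborel) < \<infinity>" if "1 \<le> q" for q
    by (rule L1_BMO_Lq[OF BMO ae u' fin that])
  have mod1: "\<exists>K\<ge>0. \<forall>h. norm h \<le> 1 \<longrightarrow> (LINT x|lborel. norm (u' (x + h) - u' x)) \<le> K * norm h powr \<sigma>"
    if "0 < \<sigma>" "\<sigma> < 1" for \<sigma>
    by (rule BD_L1_modulus[OF BD u' ae that]) blast
  \<comment> \<open>\<tau> = s p = 1 - \<epsilon> p lies strictly between 0 and 1, and \<gamma> is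
    taken halfway between \<tau> and 1.\<close>
  define \<tau> where "\<tau> = (1 / p - \<epsilon>) * p"
  define \<gamma> where "\<gamma> = (1 + \<tau>) / 2"
  have \<tau>: "0 < \<tau>" "\<tau> < 1"
  proof -
    have "\<epsilon> < 1 / p" using assms by simp
    then show "0 < \<tau>" using \<open>1 < p\<close> by (simp add: \<tau>_def)
    have "\<tau> = 1 - \<epsilon> * p" using \<open>1 < p\<close> by (simp add: \<tau>_def left_diff_distrib)
    then show "\<tau> < 1" using \<open>1 < p\<close> \<open>0 < \<epsilon>\<close> by simp
  qed
  then have \<gamma>: "0 < \<gamma>" "\<gamma> < 1" "\<tau> < \<gamma>" by (auto simp: \<gamma>_def)
  obtain K where K: "0 \<le> K"
    "\<And>h. (\<integral>\<^sup>+x. ennreal (norm (u' (x + h) - u' x) powr p) \<partial>lborel) \<le> ennreal (K * min 1 (norm h powr \<gamma>))"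
    using difference_Lp_modulus[OF int Lq mod1 \<open>1 < p\<close> \<gamma>(1,2)] by blast
  let ?e = "real CARD('n) + \<tau>"
  \<comment> \<open>Passing from \<open>lebesgue\<close> to \<open>lborel\<close> is valid for
    arbitrary nonnegative integrands, so Borel measurability is required only after \<open>u\<close>
    has been replaced by \<open>u'\<close>, first for almost every x and then for almost every
    y.\<close>
  have "(\<integral>\<^sup>+x. (\<integral>\<^sup>+y. ennreal (norm (u x - u y) powr p / norm (x - y) powr ?e) \<partial>lebesgue) \<partial>lebesgue)
    = (\<integral>\<^sup>+x. (\<integral>\<^sup>+y. ennreal (norm (u x - u y) powr p / norm (x - y) powr ?e) \<partial>lborel) \<partial>lborel)"
    by (simp only: nn_integral_completion)
  also have "\<dots> = (\<integral>\<^sup>+x. (\<integral>\<^sup>+y. ennreal (norm (u' x - u' y) powr p / norm (x - y) powr ?e) \<partial>lborel) \<partial>lborel)"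
  proof (rule nn_integral_cong_AE)
    show "AE x in lborel. (\<integral>\<^sup>+y. ennreal (norm (u x - u y) powr p / norm (x - y) powr ?e) \<partial>lborel)
      = (\<integral>\<^sup>+y. ennreal (norm (u' x - u' y) powr p / norm (x - y) powr ?e) \<partial>lborel)"
      using ae
    proof eventually_elim
      case x: (elim x)
      show ?case
      proof (rule nn_integral_cong_AE)
        show "AE y in lborel. ennreal (norm (u x - u y) powr p / norm (x - y) powr ?e)
          = ennreal (norm (u' x - u' y) powr p / norm (x - y) powr ?e)"
          using ae by eventually_elim (simp add: x)
      qed
    qed
  qed
  also have "\<dots> < \<infinity>"
    by (rule gagliardo_seminorm_finite[OF u' K \<tau>(1) \<gamma>(3)]) (use \<gamma> in simp)
  finally have "(\<integral>\<^sup>+x. (\<integral>\<^sup>+y. ennreal (norm (u x - u y) powr p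
      / norm (x - y) powr (real CARD('n) + (1 / p - \<epsilon>) * p)) \<partial>lebesgue) \<partial>lebesgue) < \<infinity>"
    by (simp only: \<tau>_def)
  moreover have "(\<integral>\<^sup>+x. ennreal (norm (u x) powr p) \<partial>lebesgue) < \<infinity>"
  proof -
    have "(\<integral>\<^sup>+x. ennreal (norm (u x) powr p) \<partial>lebesgue) = (\<integral>\<^sup>+x. ennreal (norm (u' x) powr p) \<partial>lborel)"
      unfolding nn_integral_completion using ae by (intro nn_integral_cong_AE) (auto elim!: eventually_mono)
    then show ?thesis using Lq[of p] \<open>1 < p\<close> by simp
  qed
  ultimately show "u \<in> frac_sobolev (1 / p - \<epsilon>) p"
    using meas unfolding frac_sobolev_def by blast
qed

end
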